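(* $\Delta_1(\ker\Delta_2)=\Delta_1(\ker\Delta_0)=\ell_2$.
   Context: All spaces are complex. For the couple $(X_0,X_1)=(\ell_\infty,\ell_1)$ put $\Sigma=\ell_\infty+\ell_1$. The Calderón space $\mathcal C$ of the couple is the Banach space of bounded continuous functions $F:\{z\in\mathbb C:0\le \mathrm{Re}\,z\le 1\}\to\Sigma$, analytic on the open strip, such that for $j=0,1$ the map $t\mapsto F(j+it)$ is continuous from $\mathbb R$ into $X_j$ and tends to $0$ as $|t|\to\infty$, with norm $\|F\|=\max_{j=0,1}\sup_{t}\|F(j+it)\|_{X_j}$. For $k=0,1,2$ let $\Delta_k:\mathcal C\to\Sigma$, $\Delta_k(F)=F^{(k)}(1/2)/k!$. The space $T(K)$ carries the quotient norm $\|x\|=\inf\{\|F\|:F\in K,\ TF=x\}$, and equality means equality of sets of sequences with equivalence of norms. *)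

theory Defs
  imports "HOL-Analysis.Analysis" "HOL-Library.Function_Algebras"
begin

type_synonym cseq = "nat \<Rightarrow> complex"

text \<open>A space of sequences with its own norm. The function \<open>nrm\<close> is only meaningful on \<open>carr\<close>.\<close>

record seqspace =
  carr :: "cseq set"
  nrm :: "cseq \<Rightarrow> real"

definition l_infty :: seqspace where
  "l_infty = \<lparr> carr = {x. bounded (range x)}, nrm = (\<lambda>x. SUP n. cmod (x n)) \<rparr>"

definition l_one :: seqspace where
  "l_one = \<lparr> carr = {x. summable (\<lambda>n. cmod (x n))}, nrm = (\<lambda>x. \<Sum>n. cmod (x n)) \<rparr>"

definition l_two :: seqspace where
  "l_two = \<lparr> carr = {x. summable (\<lambda>n. (cmod (x n))\<^sup>2)}, nrm = (\<lambda>x. sqrt (\<Sum>n. (cmod (x n))\<^sup>2)) \<rparr>"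

definition sum_space :: "seqspace \<Rightarrow> seqspace \<Rightarrow> seqspace" where
  "sum_space X Y =
     \<lparr> carr = {a + b | a b. a \<in> carr X \<and> b \<in> carr Y},
       nrm = (\<lambda>x. Inf {nrm X a + nrm Y b | a b. a \<in> carr X \<and> b \<in> carr Y \<and> a + b = x}) \<rparr>"

definition tendsto_in :: "seqspace \<Rightarrow> ('b \<Rightarrow> cseq) \<Rightarrow> cseq \<Rightarrow> 'b filter \<Rightarrow> bool" where
  "tendsto_in X f l A \<longleftrightarrow> ((\<lambda>t. nrm X (f t - l)) \<longlongrightarrow> 0) A"

definition continuous_into :: "seqspace \<Rightarrow> 'b::topological_space set \<Rightarrow> ('b \<Rightarrow> cseq) \<Rightarrow> bool" where
  "continuous_into X S f \<longleftrightarrow>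
     (\<forall>s\<in>S. f s \<in> carr X) \<and> (\<forall>s\<in>S. tendsto_in X f (f s) (at s within S))"

definition has_deriv_in :: "seqspace \<Rightarrow> (complex \<Rightarrow> cseq) \<Rightarrow> cseq \<Rightarrow> complex \<Rightarrow> bool" where
  "has_deriv_in X F d z \<longleftrightarrow>
     d \<in> carr X \<and> tendsto_in X (\<lambda>h n. (F (z + h) n - F z n) / h) d (at 0)"

definition deriv_in :: "seqspace \<Rightarrow> (complex \<Rightarrow> cseq) \<Rightarrow> complex \<Rightarrow> cseq" where
  "deriv_in X F z = (SOME d. has_deriv_in X F d z)"

definition strip :: "complex set" where
  "strip = {z. 0 \<le> Re z \<and> Re z \<le> 1}"

definition open_strip :: "complex set" where
  "open_strip = {z. 0 < Re z \<and> Re z < 1}"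

text \<open>Functions on the closed strip are represented by total functions vanishing off the strip,
  so that equality and the linear structure are those of functions on the strip.
  Analyticity is complex differentiability with respect to the norm of the sum space.\<close>

definition calderon :: "seqspace \<Rightarrow> seqspace \<Rightarrow> (complex \<Rightarrow> cseq) set" where
  "calderon X0 X1 = {F.
     (\<forall>z. z \<notin> strip \<longrightarrow> F z = 0) \<and>
     continuous_into (sum_space X0 X1) strip F \<and>
     (\<exists>M. \<forall>z\<in>strip. nrm (sum_space X0 X1) (F z) \<le> M) \<and>
     (\<forall>z\<in>open_strip. \<exists>d. has_deriv_in (sum_space X0 X1) F d z) \<and>
     continuous_into X0 UNIV (\<lambda>t. F (Complex 0 t)) \<and>
     tendsto_in X0 (\<lambda>t. F (Complex 0 t)) 0 at_infinity \<and>
     continuous_into X1 UNIV (\<lambda>t. F (Complex 1 t)) \<and>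
     tendsto_in X1 (\<lambda>t. F (Complex 1 t)) 0 at_infinity}"

definition calderon_norm :: "seqspace \<Rightarrow> seqspace \<Rightarrow> (complex \<Rightarrow> cseq) \<Rightarrow> real" where
  "calderon_norm X0 X1 F =
     max (SUP t. nrm X0 (F (Complex 0 t))) (SUP t. nrm X1 (F (Complex 1 t)))"

definition Delta :: "seqspace \<Rightarrow> seqspace \<Rightarrow> nat \<Rightarrow> (complex \<Rightarrow> cseq) \<Rightarrow> cseq" where
  "Delta X0 X1 k F = (\<lambda>n. ((deriv_in (sum_space X0 X1) ^^ k) F) (1/2) n / fact k)"

definition ker_Delta :: "seqspace \<Rightarrow> seqspace \<Rightarrow> nat \<Rightarrow> (complex \<Rightarrow> cseq) set" where
  "ker_Delta X0 X1 k = {F \<in> calderon X0 X1. Delta X0 X1 k F = 0}"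

definition image_space ::
    "seqspace \<Rightarrow> seqspace \<Rightarrow> ((complex \<Rightarrow> cseq) \<Rightarrow> cseq) \<Rightarrow> (complex \<Rightarrow> cseq) set \<Rightarrow> seqspace" where
  "image_space X0 X1 T K =
     \<lparr> carr = T ` K, nrm = (\<lambda>x. Inf {calderon_norm X0 X1 F | F. F \<in> K \<and> T F = x}) \<rparr>"

definition same_space :: "seqspace \<Rightarrow> seqspace \<Rightarrow> bool" where
  "same_space X Y \<longleftrightarrow>
     carr X = carr Y \<and>
     (\<exists>c>0. \<exists>C>0. \<forall>x\<in>carr X. c * nrm X x \<le> nrm Y x \<and> nrm Y x \<le> C * nrm X x)"

end

theory Submission
  imports Defs "HOL-Complex_Analysis.Complex_Analysis" "HOL-Real_Asymp.Real_Asymp"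
begin

text \<open>Write \<open>w = z - 1/2\<close>. Since \<open>\<ell>\<^sub>\<infinity> + \<ell>\<^sub>1 = \<ell>\<^sub>\<infinity>\<close> isometrically, all derivatives are taken
  coordinatewise. Pairing with extremal paths shows that the first non-vanishing Taylor coefficient of
  \<open>F\<close> at \<open>1/2\<close> is in \<open>\<ell>\<^sub>2\<close>, which settles \<open>ker \<Delta>\<^sub>0\<close>. If \<open>F''(1/2) = 0\<close>, let \<open>x = F(1/2)\<close>,
  \<open>x\<^sub>1 = F'(1/2)\<close> and subtract the extremal path \<open>x \<bar>x\<bar>\<^bsup>2w\<^esup>\<close>: then \<open>y = x\<^sub>1 - 2 x ln \<bar>x\<bar>\<close> is in \<open>\<ell>\<^sub>2\<close>.
  Subtracting a path \<open>w y \<bar>y\<bar>\<^bsup>2w\<^esup>\<close> as well, \<open>x (ln \<bar>x\<bar>)\<^sup>2 + y ln \<bar>y\<bar>\<close> is in \<open>\<ell>\<^sub>2\<close>, and a pointwise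
  inequality then puts \<open>x ln \<bar>x\<bar>\<close>, hence \<open>x\<^sub>1\<close>, in \<open>\<ell>\<^sub>2\<close>. Conversely, for \<open>x\<close> in \<open>\<ell>\<^sub>2\<close> and a weight
  \<open>l = ln q\<close> comparable to \<open>ln \<bar>x\<bar>\<close>, the path \<open>x e\<^bsup>2 l w\<^esup> w\<close> realises \<open>x\<close> in \<open>\<Delta>\<^sub>1(ker \<Delta>\<^sub>0)\<close> and
  \<open>x e\<^bsup>2 l w\<^esup> (1 / l - w)\<close> realises it in \<open>\<Delta>\<^sub>1(ker \<Delta>\<^sub>2)\<close>, up to scalar cutoffs.\<close>

subsection \<open>Sequence spaces and derivatives in the sum space\<close>

abbreviation sigma_space :: seqspace where
  "sigma_space \<equiv> sum_space l_infty l_one"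

lemma carr_l_infty: "x \<in> carr l_infty \<longleftrightarrow> (\<exists>B. \<forall>n. cmod (x n) \<le> B)"
  by (auto simp: l_infty_def bounded_iff)

lemma carr_l_infty_iff_bdd: "x \<in> carr l_infty \<longleftrightarrow> bdd_above (range (\<lambda>n. cmod (x n)))"
  by (auto simp: carr_l_infty bdd_above_def)

lemma cmod_le_nrm_l_infty: "x \<in> carr l_infty \<Longrightarrow> cmod (x n) \<le> nrm l_infty x"
  unfolding carr_l_infty_iff_bdd by (auto simp: l_infty_def intro: cSUP_upper)

lemma nrm_l_infty_le: "(\<And>n. cmod (x n) \<le> B) \<Longrightarrow> nrm l_infty x \<le> B"
  by (auto simp: l_infty_def intro: cSUP_least)

lemma carr_l_one: "x \<in> carr l_one \<longleftrightarrow> summable (\<lambda>n. cmod (x n))"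
  by (simp add: l_one_def)

lemma nrm_l_one: "nrm l_one x = (\<Sum>n. cmod (x n))"
  by (simp add: l_one_def)

lemma l_one_imp_l_infty:
  assumes "x \<in> carr l_one"
  shows "x \<in> carr l_infty" "cmod (x n) \<le> nrm l_one x"
proof -
  have *: "cmod (x n) \<le> nrm l_one x" for n
    using assms sum_le_suminf[of "\<lambda>n. cmod (x n)" "{n}"] by (simp add: carr_l_one nrm_l_one)
  then show "cmod (x n) \<le> nrm l_one x" .
  show "x \<in> carr l_infty"
    using * by (auto simp: carr_l_infty)
qed

lemma zero_in_l_one: "0 \<in> carr l_one" "nrm l_one 0 = 0"
  by (simp_all add: carr_l_one nrm_l_one)

lemma carr_sigma: "carr sigma_space = carr l_infty"
proof -
  have "a + b \<in> carr l_infty" if "a \<in> carr l_infty" "b \<in> carr l_infty" for a b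
  proof -
    obtain A B where "\<forall>n. cmod (a n) \<le> A" "\<forall>n. cmod (b n) \<le> B"
      using \<open>a \<in> carr l_infty\<close> \<open>b \<in> carr l_infty\<close> by (auto simp: carr_l_infty)
    then have "cmod ((a + b) n) \<le> A + B" for n
      using norm_triangle_mono[of "a n" A "b n" B] by simp
    then show ?thesis
      by (auto simp: carr_l_infty)
  qed
  moreover have "\<exists>a b. x = a + b \<and> a \<in> carr l_infty \<and> b \<in> carr l_one" if "x \<in> carr l_infty" for x
    using that zero_in_l_one by (metis add.right_neutral)
  ultimately show ?thesis
    using l_one_imp_l_infty(1) unfolding sum_space_def by auto
qed

text \<open>The splitting x = x + 0 attains the infimum: in any splitting a + b the
  \<open>l_one\<close> norm of b dominates its sup norm.\<close>

lemma nrm_sigma: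
  assumes "x \<in> carr l_infty"
  shows "nrm sigma_space x = nrm l_infty x"
proof -
  let ?S = "{nrm l_infty a + nrm l_one b | a b. a \<in> carr l_infty \<and> b \<in> carr l_one \<and> a + b = x}"
  have mem: "nrm l_infty x \<in> ?S"
    using assms zero_in_l_one by (intro CollectI exI[of _ x] exI[of _ 0]) simp
  have low: "nrm l_infty x \<le> s" if s: "s \<in> ?S" for s
  proof -
    from s obtain a b where ab: "a \<in> carr l_infty" "b \<in> carr l_one" "a + b = x"
        and [simp]: "s = nrm l_infty a + nrm l_one b"
      by auto
    show ?thesis
    proof (rule nrm_l_infty_le)
      fix n
      have "cmod (x n) \<le> cmod (a n) + cmod (b n)"
        using ab(3) norm_triangle_ineq by auto
      then show "cmod (x n) \<le> s"
        using cmod_le_nrm_l_infty[OF ab(1), of n] l_one_imp_l_infty(2)[OF ab(2), of n] by simp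
    qed
  qed
  have "Inf ?S = nrm l_infty x"
    using mem low by (intro cInf_eq_minimum) auto
  then show ?thesis
    by (simp add: sum_space_def)
qed

lemma carr_sigmaI: "(\<And>n. cmod (x n) \<le> B) \<Longrightarrow> x \<in> carr sigma_space"
  by (auto simp: carr_sigma carr_l_infty)

lemma nrm_sigma_le: "(\<And>n. cmod (x n) \<le> B) \<Longrightarrow> nrm sigma_space x \<le> B"
  using nrm_sigma[of x] nrm_l_infty_le[of x B] carr_l_infty[of x] by metis

lemma cmod_le_nrm_sigma: "x \<in> carr sigma_space \<Longrightarrow> cmod (x n) \<le> nrm sigma_space x"
  using nrm_sigma[of x] cmod_le_nrm_l_infty[of x] by (auto simp: carr_sigma)

lemma nrm_sigma_nonneg: "x \<in> carr sigma_space \<Longrightarrow> 0 \<le> nrm sigma_space x"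
  using cmod_le_nrm_sigma[of x 0] norm_ge_zero[of "x 0"] by linarith

lemma carr_sigma_diff:
  assumes "x \<in> carr sigma_space" "y \<in> carr sigma_space"
  shows "x - y \<in> carr sigma_space"
proof (rule carr_sigmaI)
  show "cmod ((x - y) n) \<le> nrm sigma_space x + nrm sigma_space y" for n
    using norm_triangle_ineq4[of "x n" "y n"] cmod_le_nrm_sigma[OF assms(1), of n]
      cmod_le_nrm_sigma[OF assms(2), of n] by simp
qed

text \<open>The norm of the sum space dominates each coordinate, so a norm limit of difference
  quotients is a limit in every coordinate.\<close>

lemma has_deriv_in_sigma_coord:
  assumes d: "has_deriv_in sigma_space F d z" and S: "open S" "z \<in> S"
    and F: "\<And>w. w \<in> S \<Longrightarrow> F w \<in> carr sigma_space"
  shows "((\<lambda>w. F w n) has_field_derivative d n) (at z)"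
proof -
  let ?q = "\<lambda>h n. (F (z + h) n - F z n) / h"
  have "((\<lambda>h. z + h) \<longlongrightarrow> z + 0) (at 0)"
    by (intro tendsto_intros)
  then have "eventually (\<lambda>h. z + h \<in> S) (at 0)"
    using S by (simp add: topological_tendstoD)
  \<comment> \<open>The norm controls coordinates only on the carrier, so membership of the quotient
    is checked first; it holds as soon as z + h lies in S.\<close>
  then have "eventually (\<lambda>h. cmod (?q h n - d n) \<le> nrm sigma_space (?q h - d)) (at 0)"
  proof eventually_elim
    case (elim h)
    let ?x = "F (z + h) - F z"
    have "?x \<in> carr sigma_space"
      using F elim S by (intro carr_sigma_diff) auto
    then have "cmod (?q h m) \<le> nrm sigma_space ?x / cmod h" for m
      using cmod_le_nrm_sigma[of ?x m] by (simp add: norm_divide divide_right_mono)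
    then have "?q h \<in> carr sigma_space"
      by (rule carr_sigmaI)
    then have "?q h - d \<in> carr sigma_space"
      using d by (intro carr_sigma_diff) (auto simp: has_deriv_in_def)
    from cmod_le_nrm_sigma[OF this, of n] show ?case
      by simp
  qed
  moreover have "((\<lambda>h. nrm sigma_space (?q h - d)) \<longlongrightarrow> 0) (at 0)"
    using d by (simp add: has_deriv_in_def tendsto_in_def)
  ultimately have "((\<lambda>h. ?q h n - d n) \<longlongrightarrow> 0) (at 0)"
    by (rule Lim_null_comparison)
  then show ?thesis
    unfolding DERIV_def by (simp add: Lim_null[symmetric])
qed

text \<open>Cauchy's inequality on a small disc. The bound sees f only through B, hence is the same
  for all coordinates of a bounded path.\<close>

lemma higher_deriv_bound:
  assumes f: "f holomorphic_on ball z r" and B: "\<And>w. w \<in> ball z r \<Longrightarrow> cmod (f w) \<le> B"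
    and s: "0 < s" "cball x s \<subseteq> ball z r"
  shows "cmod ((deriv ^^ k) f x) \<le> fact k * B / s ^ k"
proof (rule Cauchy_inequality)
  show "f holomorphic_on ball x s"
    using f s(2) by (meson ball_subset_cball holomorphic_on_subset)
  show "continuous_on (cball x s) f"
    using f s(2) holomorphic_on_imp_continuous_on holomorphic_on_subset by blast
  show "cmod (f y) \<le> B" if "cmod (x - y) = s" for y
    using that s(2) by (intro B) (auto simp: subset_iff dist_norm)
qed (use s in auto)

text \<open>A common bound B on the coordinates makes the second-order Taylor remainder uniform in
  n, so coordinatewise difference quotients converge in sup norm.\<close>

lemma has_deriv_in_sigmaI:
  assumes r: "0 < r" and hol: "\<And>n. (\<lambda>w. F w n) holomorphic_on ball z r"
    and B: "\<And>w n. w \<in> ball z r \<Longrightarrow> cmod (F w n) \<le> B"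
  shows "has_deriv_in sigma_space F (\<lambda>n. deriv (\<lambda>w. F w n) z) z"
proof -
  \<comment> \<open>Discs of radius r/4 about points of the half-size ball stay inside
    \<open>ball z r\<close>, which leaves room for Cauchy's inequality.\<close>
  define s where "s = r / 4"
  have s: "0 < s"
    using r by (simp add: s_def)
  have sub: "cball x s \<subseteq> ball z r" if "x \<in> ball z (r/2)" for x
  proof
    fix y assume "y \<in> cball x s"
    then show "y \<in> ball z r"
      using that r dist_triangle[of z y x] by (auto simp: s_def)
  qed
  let ?D = "\<lambda>n k. (deriv ^^ k) (\<lambda>w. F w n)"
  have bd: "cmod (?D n k x) \<le> fact k * B / s ^ k" if "x \<in> ball z (r/2)" for n k x
    using higher_deriv_bound[OF hol B s sub[OF that]] by simp
  \<comment> \<open>The Cauchy bound \<open>fact 2 * B / s^2\<close> for second derivatives.\<close>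
  define C where "C = 2 * B / s\<^sup>2"
  have est: "cmod ((F (z + h) n - F z n) / h - deriv (\<lambda>w. F w n) z) \<le> C * cmod h"
    if h: "cmod h < r / 2" "h \<noteq> 0" for h n
  proof -
    have "cmod (?D n 0 (z + h) - (\<Sum>i\<le>1. ?D n i z * (z + h - z) ^ i / fact i))
        \<le> C * cmod (z + h - z) ^ Suc 1 / fact 1"
    proof (rule complex_Taylor)
      show "convex (ball z (r/2))" by simp
      show "(?D n i has_field_derivative ?D n (Suc i) x) (at x within ball z (r/2))"
        if "x \<in> ball z (r/2)" for i x
      proof -
        have "?D n i holomorphic_on ball z r"
          by (intro holomorphic_higher_deriv hol open_ball)
        moreover have "x \<in> ball z r"
          using that r by auto
        ultimately have "(?D n i has_field_derivative deriv (?D n i) x) (at x)"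
          by (intro holomorphic_derivI[of _ "ball z r"]) auto
        then show ?thesis
          by (auto intro: has_field_derivative_at_within)
      qed
      show "cmod (?D n (Suc 1) x) \<le> C" if "x \<in> ball z (r/2)" for x
        using bd[OF that, of 2 n] by (simp add: C_def numeral_2_eq_2)
    qed (use h r in \<open>auto simp: dist_norm\<close>)
    then have "cmod (F (z + h) n - F z n - deriv (\<lambda>w. F w n) z * h) \<le> C * (cmod h)\<^sup>2"
      by (simp add: power2_eq_square algebra_simps)
    then have "cmod (F (z + h) n - F z n - deriv (\<lambda>w. F w n) z * h) / cmod h \<le> C * cmod h"
      using h by (simp add: power2_eq_square field_simps)
    moreover have "(F (z + h) n - F z n) / h - deriv (\<lambda>w. F w n) z
        = (F (z + h) n - F z n - deriv (\<lambda>w. F w n) z * h) / h"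
      using h by (simp add: field_simps)
    ultimately show ?thesis
      by (simp add: norm_divide)
  qed
  have "eventually (\<lambda>h. norm (nrm sigma_space ((\<lambda>n. (F (z + h) n - F z n) / h) - (\<lambda>n. deriv (\<lambda>w. F w n) z)))
           \<le> C * cmod h) (at 0)"
    unfolding eventually_at
  proof (intro exI[of _ "r/2"] conjI ballI impI)
    fix h :: complex assume "h \<noteq> 0 \<and> dist h 0 < r / 2"
    then have e: "\<And>n. cmod (((\<lambda>n. (F (z + h) n - F z n) / h) - (\<lambda>n. deriv (\<lambda>w. F w n) z)) n) \<le> C * cmod h"
      using est[of h] by simp
    have "0 \<le> nrm sigma_space ((\<lambda>n. (F (z + h) n - F z n) / h) - (\<lambda>n. deriv (\<lambda>w. F w n) z))"
      by (rule nrm_sigma_nonneg[OF carr_sigmaI[OF e]])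
    then show "norm (nrm sigma_space ((\<lambda>n. (F (z + h) n - F z n) / h) - (\<lambda>n. deriv (\<lambda>w. F w n) z)))
           \<le> C * cmod h"
      using nrm_sigma_le[OF e] by (simp only: real_norm_def abs_of_nonneg)
  qed (use r in simp)
  moreover have "((\<lambda>h. C * cmod h) \<longlongrightarrow> 0) (at 0)"
    by (auto intro!: tendsto_eq_intros)
  ultimately have "tendsto_in sigma_space (\<lambda>h n. (F (z + h) n - F z n) / h) (\<lambda>n. deriv (\<lambda>w. F w n) z) (at 0)"
    unfolding tendsto_in_def by (rule Lim_null_comparison)
  moreover have "(\<lambda>n. deriv (\<lambda>w. F w n) z) \<in> carr sigma_space"
    using bd[of z 1] r by (intro carr_sigmaI[of _ "B / s"]) auto
  ultimately show ?thesis
    by (simp add: has_deriv_in_def)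
qed

text \<open>The choice in \<open>deriv_in\<close> is harmless: any norm derivative has the
  coordinate derivatives as its entries and is therefore unique.\<close>

lemma deriv_in_sigma:
  assumes r: "0 < r" and hol: "\<And>n. (\<lambda>w. F w n) holomorphic_on ball z r"
    and B: "\<And>w n. w \<in> ball z r \<Longrightarrow> cmod (F w n) \<le> B"
  shows "deriv_in sigma_space F z = (\<lambda>n. deriv (\<lambda>w. F w n) z)"
  unfolding deriv_in_def
proof (rule some_equality)
  show "has_deriv_in sigma_space F (\<lambda>n. deriv (\<lambda>w. F w n) z) z"
    by (rule has_deriv_in_sigmaI[where F = F, OF assms])
  fix d assume "has_deriv_in sigma_space F d z"
  then have "((\<lambda>w. F w n) has_field_derivative d n) (at z)" for n
    by (rule has_deriv_in_sigma_coord[of _ _ _ "ball z r"]) (use r B in \<open>auto intro: carr_sigmaI\<close>)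
  then show "d = (\<lambda>n. deriv (\<lambda>w. F w n) z)"
    by (intro ext DERIV_imp_deriv[symmetric])
qed

section \<open>Taylor coefficients at 1/2, computed coordinatewise\<close>

lemma open_open_strip: "open open_strip"
  unfolding open_strip_def by (intro open_Collect_conj open_Collect_less continuous_intros)

lemma open_strip_subset: "open_strip \<subseteq> strip"
  by (auto simp: open_strip_def strip_def)

lemma half_in_strip: "1/2 \<in> open_strip" "1/2 \<in> strip"
  by (auto simp: open_strip_def strip_def)

text \<open>The induction hypothesis describes the iterate only on the open strip. It is therefore
  replaced by coordinate derivatives on a small ball before differentiating once more; Cauchy's
  estimate keeps these bounded uniformly in n, as \<open>deriv_in_sigma\<close> demands.\<close>

lemma higher_deriv_in_sigma:
  assumes hol: "\<And>n. (\<lambda>w. F w n) holomorphic_on open_strip"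
    and B: "\<And>w n. w \<in> open_strip \<Longrightarrow> cmod (F w n) \<le> B"
    and z: "z \<in> open_strip"
  shows "(deriv_in sigma_space ^^ k) F z = (\<lambda>n. (deriv ^^ k) (\<lambda>w. F w n) z)"
  using z
proof (induction k arbitrary: z)
  case 0
  then show ?case by simp
next
  case (Suc k)
  obtain r where r: "0 < r" "ball z r \<subseteq> open_strip"
    using Suc.prems open_open_strip open_contains_ball by blast
  let ?G = "(deriv_in sigma_space ^^ k) F"
  let ?D = "\<lambda>n k. (deriv ^^ k) (\<lambda>w. F w n)"
  have holr: "(\<lambda>w. F w n) holomorphic_on ball z r" for n
    using hol r by (meson holomorphic_on_subset)
  have sub: "cball x (r/4) \<subseteq> ball z r" if "x \<in> ball z (r/2)" for x
  proof
    fix y assume "y \<in> cball x (r/4)"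
    then show "y \<in> ball z r"
      using that r dist_triangle[of z y x] by auto
  qed
  have eq: "?G w n = ?D n k w" if "w \<in> ball z (r/2)" for w n
    using Suc.IH[of w] that r by (auto simp: subset_iff)
  have "deriv_in sigma_space ?G z = (\<lambda>n. deriv (\<lambda>w. ?G w n) z)"
  proof (rule deriv_in_sigma)
    show "0 < r / 2" using r by simp
    have "?D n k holomorphic_on ball z (r/2)" for n
      by (rule holomorphic_on_subset[of _ "ball z r"])
        (use holr r(1) in \<open>auto intro!: holomorphic_higher_deriv\<close>)
    then show "(\<lambda>w. ?G w n) holomorphic_on ball z (r/2)" for n
      by (rule holomorphic_transform) (simp add: eq)
    show "cmod (?G w n) \<le> fact k * B / (r/4) ^ k" if "w \<in> ball z (r/2)" for w n
      unfolding eq[OF that] using r that B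
      by (intro higher_deriv_bound[OF holr _ _ sub]) auto
  qed
  also have "\<dots> = (\<lambda>n. deriv (?D n k) z)"
  proof (intro ext deriv_cong_ev refl)
    show "\<forall>\<^sub>F w in nhds z. ?G w n = ?D n k w" for n
    proof (rule eventually_mono[OF eventually_nhds_in_open[of "ball z (r/2)" z]])
    qed (use r(1) eq in auto)
  qed
  finally show ?case
    by simp
qed

lemma Delta_eq:
  assumes "\<And>n. (\<lambda>w. F w n) holomorphic_on open_strip"
    and "\<And>w n. w \<in> open_strip \<Longrightarrow> cmod (F w n) \<le> B"
  shows "Delta l_infty l_one k F = (\<lambda>n. (deriv ^^ k) (\<lambda>w. F w n) (1/2) / fact k)"
proof -
  have "(deriv_in sigma_space ^^ k) F (1/2) = (\<lambda>n. (deriv ^^ k) (\<lambda>w. F w n) (1/2))"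
    by (rule higher_deriv_in_sigma[where F = F, OF assms half_in_strip(1)])
  then show ?thesis
    by (simp add: Delta_def)
qed

subsection \<open>Estimates for interpolation paths\<close>

lemma strip_imp_Complex: "z \<in> strip \<Longrightarrow> 0 \<le> Re z" "z \<in> strip \<Longrightarrow> Re z \<le> 1"
  by (auto simp: strip_def)

text \<open>Phragmen-Lindeloef: after damping by a Gaussian factor, the maximum principle applies on
  a tall rectangle whose horizontal edges contribute less than e. Then e tends to 0.\<close>

lemma three_lines:
  assumes hol: "f holomorphic_on open_strip" and cont: "continuous_on strip f"
    and B: "\<And>w. w \<in> strip \<Longrightarrow> cmod (f w) \<le> B"
    and M0: "\<And>t. cmod (f (Complex 0 t)) \<le> M" and M1: "\<And>t. cmod (f (Complex 1 t)) \<le> M"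
    and z: "z \<in> strip"
  shows "cmod (f z) \<le> M"
proof -
  have Mpos: "0 \<le> M" using M0[of 0] norm_ge_zero order_trans by blast
  have Bpos: "0 \<le> B" using B[OF z] norm_ge_zero order_trans by blast
  \<comment> \<open>On the strip the real part of w^2 - 1 is at most -(Im w)^2: the factor is
    bounded by 1 and decays vertically.\<close>
  let ?u = "\<lambda>e::real. \<lambda>w::complex. exp (e * (w\<^sup>2 - 1))"
  have nu: "cmod (?u e w) = exp (e * ((Re w)\<^sup>2 - (Im w)\<^sup>2 - 1))" for e w
    by (simp add: power2_eq_square)
  have key: "cmod (f z) * cmod (?u e z) \<le> M + e" if e: "0 < e" for e
  proof -
    have nu_le: "cmod (?u e w) \<le> exp (- e * (Im w)\<^sup>2)" if "w \<in> strip" for w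
    proof -
      have "(Re w)\<^sup>2 \<le> 1"
        using strip_imp_Complex[OF that] by (simp add: power_le_one)
      then have "e * ((Re w)\<^sup>2 - (Im w)\<^sup>2 - 1) \<le> e * (- (Im w)\<^sup>2)"
        using e by (intro mult_left_mono) auto
      then show ?thesis
        unfolding nu by simp
    qed
    have nu1: "cmod (?u e w) \<le> 1" if "w \<in> strip" for w
      using nu_le[OF that] e by (smt (verit) exp_le_one_iff mult_nonneg_nonneg mult_minus_left zero_le_power2)
    have "((\<lambda>T. B * exp (- e * T\<^sup>2)) \<longlongrightarrow> 0) at_top"
      using e by real_asymp
    then have "\<forall>\<^sub>F T in at_top. B * exp (- e * T\<^sup>2) < e"
      using e by (simp add: order_tendstoD)
    then have "\<forall>\<^sub>F T in at_top. B * exp (- e * T\<^sup>2) < e \<and> \<bar>Im z\<bar> < T"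
      using eventually_gt_at_top by (rule eventually_conj)
    then obtain T where T: "B * exp (- e * T\<^sup>2) < e" "\<bar>Im z\<bar> < T"
      using eventually_happens' trivial_limit_at_top_linorder by blast
    let ?S = "cbox (Complex 0 (-T)) (Complex 1 T)"
    have sub: "?S \<subseteq> strip" "interior ?S \<subseteq> open_strip"
      by (auto simp: interior_cbox in_cbox_complex_iff in_box_complex_iff strip_def open_strip_def)
    have "cmod (f z * ?u e z) \<le> M + e"
    proof (rule maximum_modulus_frontier[of "\<lambda>w. f w * ?u e w" ?S])
      show "(\<lambda>w. f w * ?u e w) holomorphic_on interior ?S"
        using sub(2) hol by (intro holomorphic_intros) (auto intro: holomorphic_on_subset)
      show "continuous_on (closure ?S) (\<lambda>w. f w * ?u e w)"
        using sub(1) cont by (intro continuous_intros) (auto intro: continuous_on_subset)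
      show "bounded ?S" by simp
      show "z \<in> ?S"
        using z T(2) by (auto simp: in_cbox_complex_iff strip_def)
      fix w assume w: "w \<in> frontier ?S"
      then have wS: "w \<in> strip"
        using sub(1) by (auto simp: frontier_def)
      have "Re w = 0 \<or> Re w = 1 \<or> \<bar>Im w\<bar> = T"
        using w T(2) by (auto simp: frontier_def interior_cbox in_cbox_complex_iff in_box_complex_iff)
      then consider "Re w = 0" | "Re w = 1" | "\<bar>Im w\<bar> = T"
        by blast
      then show "cmod (f w * ?u e w) \<le> M + e"
      proof cases
        case 1
        then have "w = Complex 0 (Im w)" by (simp add: complex_eq_iff)
        then have "cmod (f w) \<le> M" using M0[of "Im w"] by simp
        then have "cmod (f w) * cmod (?u e w) \<le> M * 1"
          using nu1[OF wS] Mpos by (intro mult_mono) auto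
        then show ?thesis using e by (simp add: norm_mult)
      next
        case 2
        then have "w = Complex 1 (Im w)" by (simp add: complex_eq_iff)
        then have "cmod (f w) \<le> M" using M1[of "Im w"] by simp
        then have "cmod (f w) * cmod (?u e w) \<le> M * 1"
          using nu1[OF wS] Mpos by (intro mult_mono) auto
        then show ?thesis using e by (simp add: norm_mult)
      next
        case 3
        then have "(Im w)\<^sup>2 = T\<^sup>2" by (metis power2_abs)
        then have "cmod (f w) * cmod (?u e w) \<le> B * exp (- e * T\<^sup>2)"
          using nu_le[OF wS] B[OF wS] Bpos by (intro mult_mono) auto
        then show ?thesis using T(1) Mpos by (simp add: norm_mult)
      qed
    qed
    then show ?thesis
      by (simp add: norm_mult)
  qed
  have "((\<lambda>e. cmod (f z) * cmod (?u e z)) \<longlongrightarrow> cmod (f z) * cmod (?u 0 z)) (at_right 0)"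
    by (intro tendsto_intros)
  moreover have "((\<lambda>e. M + e) \<longlongrightarrow> M + 0) (at_right 0)"
    by (intro tendsto_intros)
  moreover have "\<forall>\<^sub>F e in at_right 0. cmod (f z) * cmod (?u e z) \<le> M + e"
    using key by (auto simp: eventually_at_right_less intro: eventually_mono[OF eventually_at_right_less])
  ultimately have "cmod (f z) * cmod (?u 0 z) \<le> M + 0"
    by (intro tendsto_le[of "at_right (0::real)"]) auto
  then show ?thesis by simp
qed

section \<open>Leading Taylor coefficients of paths with boundary bounds\<close>

lemma higher_deriv_sum:
  assumes "finite A" "\<And>a. a \<in> A \<Longrightarrow> f a holomorphic_on S" "open S" "z \<in> S"
  shows "(deriv ^^ k) (\<lambda>w. \<Sum>a\<in>A. f a w) z = (\<Sum>a\<in>A. (deriv ^^ k) (f a) z)"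
  using assms(1,2)
proof (induction A rule: finite_induct)
  case empty
  then show ?case
    by (cases k) (simp_all add: higher_deriv_const)
next
  case (insert a A)
  have "(deriv ^^ k) (\<lambda>w. f a w + (\<Sum>a\<in>A. f a w)) z
      = (deriv ^^ k) (f a) z + (deriv ^^ k) (\<lambda>w. \<Sum>a\<in>A. f a w) z"
    using insert.prems by (intro higher_deriv_add[OF _ _ assms(3,4)] holomorphic_on_sum) auto
  then show ?case
    using insert by simp
qed

text \<open>Weaker than membership in the Calderon space: no vector-valued continuity and no decay.
  The extremal paths have constant modulus along vertical lines, so they qualify here although they
  do not vanish at infinity. The bound B may depend on n, since only finite sums of coordinates are
  ever paired.\<close>

definition admissible :: "real \<Rightarrow> (complex \<Rightarrow> cseq) \<Rightarrow> bool" where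
  "admissible M F \<longleftrightarrow>
     (\<forall>n. continuous_on strip (\<lambda>z. F z n) \<and> (\<lambda>z. F z n) holomorphic_on open_strip \<and>
          (\<exists>B. \<forall>z\<in>strip. cmod (F z n) \<le> B)) \<and>
     (\<forall>t n. cmod (F (Complex 0 t) n) \<le> M) \<and>
     (\<forall>t N. (\<Sum>n<N. cmod (F (Complex 1 t) n)) \<le> M)"

lemma admissibleD:
  assumes "admissible M F"
  shows "continuous_on strip (\<lambda>z. F z n)" "(\<lambda>z. F z n) holomorphic_on open_strip"
    "\<exists>B. \<forall>z\<in>strip. cmod (F z n) \<le> B"
    "cmod (F (Complex 0 t) n) \<le> M" "(\<Sum>n<N. cmod (F (Complex 1 t) n)) \<le> M" "0 \<le> M"
proof -
  show "cmod (F (Complex 0 t) n) \<le> M" for t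
    using assms by (auto simp: admissible_def)
  from this[of 0] show "0 \<le> M"
    using norm_ge_zero order_trans by blast
qed (use assms in \<open>auto simp: admissible_def\<close>)

lemma admissible_diff:
  assumes F: "admissible M F" and G: "admissible L G"
  shows "admissible (M + L) (\<lambda>z n. F z n - G z n)"
  unfolding admissible_def
proof (intro conjI allI)
  fix n
  show "continuous_on strip (\<lambda>z. F z n - G z n)" "(\<lambda>z. F z n - G z n) holomorphic_on open_strip"
    using admissibleD[OF F] admissibleD[OF G] by (auto intro: continuous_intros holomorphic_intros)
  obtain A B where AB: "\<And>z. z \<in> strip \<Longrightarrow> cmod (F z n) \<le> A" "\<And>z. z \<in> strip \<Longrightarrow> cmod (G z n) \<le> B"
    using admissibleD(3)[OF F, of n] admissibleD(3)[OF G, of n] by blast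
  have "cmod (F z n - G z n) \<le> A + B" if "z \<in> strip" for z
    using AB[OF that] norm_triangle_ineq4[of "F z n" "G z n"] by simp
  then show "\<exists>B. \<forall>z\<in>strip. cmod (F z n - G z n) \<le> B"
    by blast
  show "cmod (F (Complex 0 t) n - G (Complex 0 t) n) \<le> M + L" for t
    using admissibleD(4)[OF F, of t n] admissibleD(4)[OF G, of t n]
      norm_triangle_ineq4[of "F (Complex 0 t) n" "G (Complex 0 t) n"] by simp
next
  fix t N
  have "(\<Sum>n<N. cmod (F (Complex 1 t) n - G (Complex 1 t) n))
      \<le> (\<Sum>n<N. cmod (F (Complex 1 t) n) + cmod (G (Complex 1 t) n))"
    by (intro sum_mono norm_triangle_ineq4)
  also have "\<dots> \<le> M + L"
    unfolding sum.distrib by (intro add_mono admissibleD(5)[OF F] admissibleD(5)[OF G])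
  finally show "(\<Sum>n<N. cmod (F (Complex 1 t) n - G (Complex 1 t) n)) \<le> M + L" .
qed

lemma admissible_mult:
  assumes F: "admissible M F"
    and u: "continuous_on strip u" "u holomorphic_on open_strip" "\<And>z. z \<in> strip \<Longrightarrow> cmod (u z) \<le> C"
  shows "admissible (C * M) (\<lambda>z n. u z * F z n)"
  unfolding admissible_def
proof (intro conjI allI)
  have C: "0 \<le> C"
    using u(3)[OF half_in_strip(2)] norm_ge_zero order_trans by blast
  fix n
  show "continuous_on strip (\<lambda>z. u z * F z n)" "(\<lambda>z. u z * F z n) holomorphic_on open_strip"
    using admissibleD[OF F] u by (auto intro: continuous_intros holomorphic_intros)
  obtain A where A: "\<And>z. z \<in> strip \<Longrightarrow> cmod (F z n) \<le> A"
    using admissibleD(3)[OF F, of n] by blast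
  have "cmod (u z * F z n) \<le> C * A" if "z \<in> strip" for z
    unfolding norm_mult by (intro mult_mono A u that C) auto
  then show "\<exists>B. \<forall>z\<in>strip. cmod (u z * F z n) \<le> B"
    by blast
  show "cmod (u (Complex 0 t) * F (Complex 0 t) n) \<le> C * M" for t
    unfolding norm_mult by (intro mult_mono admissibleD[OF F] u C) (auto simp: strip_def)
next
  fix t N
  have C: "0 \<le> C"
    using u(3)[OF half_in_strip(2)] norm_ge_zero order_trans by blast
  have "(\<Sum>n<N. cmod (u (Complex 1 t) * F (Complex 1 t) n)) = cmod (u (Complex 1 t)) * (\<Sum>n<N. cmod (F (Complex 1 t) n))"
    by (simp add: norm_mult sum_distrib_left)
  also have "\<dots> \<le> C * M"
    by (intro mult_mono u admissibleD[OF F] C sum_nonneg) (auto simp: strip_def)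
  finally show "(\<Sum>n<N. cmod (u (Complex 1 t) * F (Complex 1 t) n)) \<le> C * M" .
qed

text \<open>Pairing with the extremal path \<open>g\<close> of the normalised dual sequence reduces the estimate to
  the Cauchy inequality for one scalar function on the disc of radius \<open>1/2\<close> in the strip.\<close>

lemma leading_coefficient_l_two:
  assumes F: "admissible M F"
    and van: "\<And>n j. j < k \<Longrightarrow> (deriv ^^ j) (\<lambda>z. F z n) (1/2) = 0"
  shows "(\<Sum>n<N. (cmod ((deriv ^^ k) (\<lambda>z. F z n) (1/2)))\<^sup>2) \<le> (fact k * 2 ^ k * M)\<^sup>2"
proof -
  define x where "x n = (deriv ^^ k) (\<lambda>z. F z n) (1/2)" for n
  define S where "S = (\<Sum>n<N. (cmod (x n))\<^sup>2)"
  note FD = admissibleD[OF F]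
  have "S \<le> (fact k * 2 ^ k * M)\<^sup>2"
  proof (cases "S = 0")
    case False
    moreover have "0 \<le> S" unfolding S_def by (intro sum_nonneg) auto
    ultimately have S: "0 < S" by simp
    define l where "l n = ln (cmod (x n) / sqrt S)" for n
    \<comment> \<open>Dual to F on the boundary: for nonzero \<open>x n\<close> the modulus is |x
      n|^2 / S on \<open>Re z = 0\<close>, summing to 1 over n < N, and 1 on
      \<open>Re z = 1\<close>. At 1/2 the pairing with x gives sqrt S.\<close>
    define g where "g n z = (if x n = 0 then 0 else cnj (sgn (x n)) * exp (complex_of_real (2 * l n) * (1 - z)))"
      for n z
    have g0: "g n z = 0" if "x n = 0" for n z
      using that by (simp add: g_def)
    have ng: "cmod (g n z) = exp (2 * l n * (1 - Re z))" if "x n \<noteq> 0" for n z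
      using that by (simp add: g_def norm_mult norm_sgn)
    have expl: "exp (l n) = cmod (x n) / sqrt S" if "x n \<noteq> 0" for n
      using that S by (simp add: l_def)
    have l_le: "l n \<le> 0" if "n < N" for n
    proof -
      have "(cmod (x n))\<^sup>2 \<le> S"
        unfolding S_def using that by (intro member_le_sum) auto
      then have "cmod (x n) \<le> sqrt S"
        by (rule real_le_rsqrt)
      then show ?thesis
        using S by (cases "x n = 0") (auto simp: l_def)
    qed
    define H where "H z = (\<Sum>n<N. F z n * g n z)" for z
    have holg: "g n holomorphic_on UNIV" for n
      unfolding g_def by (cases "x n = 0") (auto intro!: holomorphic_intros)
    have holH: "H holomorphic_on open_strip"
      unfolding H_def using FD(2) holg
      by (intro holomorphic_intros) (auto intro: holomorphic_on_subset)
    have contH: "continuous_on strip H"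
      unfolding H_def using FD(1) holomorphic_on_imp_continuous_on[OF holg]
      by (intro continuous_intros) (auto intro: continuous_on_subset)
    have g_le: "cmod (g n z) \<le> 1" if "n < N" "z \<in> strip" for n z
      using l_le[OF that(1)] strip_imp_Complex[OF that(2)]
      by (cases "x n = 0") (simp_all add: g0 ng mult_nonpos_nonneg)
    obtain B where B: "\<And>n z. z \<in> strip \<Longrightarrow> cmod (F z n) \<le> B n"
      using FD(3) by metis
    have bdH: "cmod (H z) \<le> (\<Sum>n<N. B n)" if "z \<in> strip" for z
      unfolding H_def
    proof (rule sum_norm_le)
      fix n assume "n \<in> {..<N}"
      then have "cmod (F z n) * cmod (g n z) \<le> B n * 1"
        using that B[OF that, of n] by (intro mult_mono g_le) (auto intro: order_trans[OF norm_ge_zero])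
      then show "cmod (F z n * g n z) \<le> B n" by (simp add: norm_mult)
    qed
    have H0: "cmod (H (Complex 0 t)) \<le> M" for t
    proof -
      have "cmod (H (Complex 0 t)) \<le> (\<Sum>n<N. M * ((cmod (x n))\<^sup>2 / S))"
        unfolding H_def
      proof (rule sum_norm_le)
        fix n
        have "cmod (g n (Complex 0 t)) \<le> (cmod (x n))\<^sup>2 / S"
        proof (cases "x n = 0")
          case False
          have "exp (2 * l n) = (exp (l n))\<^sup>2"
            by (simp add: exp_double)
          then show ?thesis
            using S False by (simp add: ng expl power_divide)
        qed (simp add: g0)
        then show "cmod (F (Complex 0 t) n * g n (Complex 0 t)) \<le> M * ((cmod (x n))\<^sup>2 / S)"
          unfolding norm_mult using FD(4) FD(6) by (intro mult_mono) auto
      qed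
      also have "\<dots> = M * (S / S)"
        by (simp add: S_def sum_distrib_left[symmetric] sum_divide_distrib[symmetric])
      finally show ?thesis using S by simp
    qed
    have H1: "cmod (H (Complex 1 t)) \<le> M" for t
    proof -
      have "cmod (H (Complex 1 t)) \<le> (\<Sum>n<N. cmod (F (Complex 1 t) n))"
        unfolding H_def
      proof (rule sum_norm_le)
        fix n assume "n \<in> {..<N}"
        then show "cmod (F (Complex 1 t) n * g n (Complex 1 t)) \<le> cmod (F (Complex 1 t) n)"
          using mult_left_mono[OF g_le[of n "Complex 1 t"], of "cmod (F (Complex 1 t) n)"]
          by (simp add: norm_mult strip_def)
      qed
      then show ?thesis using FD(5) order_trans by blast
    qed
    have sub: "ball (1/2) (1/2) \<subseteq> open_strip" "cball (1/2) (1/2) \<subseteq> strip"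
    proof -
      have *: "\<bar>1/2 - Re z\<bar> \<le> dist (1/2) z" for z :: complex
        using abs_Re_le_cmod[of "1/2 - z"] by (simp add: dist_norm)
      show "ball (1/2) (1/2) \<subseteq> open_strip"
      proof
        fix z :: complex assume "z \<in> ball (1/2) (1/2)"
        then show "z \<in> open_strip"
          using *[of z] by (auto simp: open_strip_def)
      qed
      show "cball (1/2) (1/2) \<subseteq> strip"
      proof
        fix z :: complex assume "z \<in> cball (1/2) (1/2)"
        then show "z \<in> strip"
          using *[of z] by (auto simp: strip_def)
      qed
    qed
    \<comment> \<open>The radius 1/2 of the inscribed disc is the source of the factor 2^k. The disc
      touches the boundary lines, where continuity of H is enough.\<close>
    have cauchy: "cmod ((deriv ^^ k) H (1/2)) \<le> fact k * M / (1/2) ^ k"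
    proof (rule Cauchy_inequality)
      show "H holomorphic_on ball (1/2) (1/2)" "continuous_on (cball (1/2) (1/2)) H"
        using holH contH sub by (auto intro: holomorphic_on_subset continuous_on_subset)
      show "cmod (H z) \<le> M" if "cmod (1/2 - z) = 1/2" for z
        using that sub(2)
        by (intro three_lines[OF holH contH bdH H0 H1]) (auto simp: subset_iff dist_norm)
    qed simp
    have "(deriv ^^ k) H (1/2) = (\<Sum>n<N. (deriv ^^ k) (\<lambda>z. F z n * g n z) (1/2))"
      unfolding H_def using FD(2) holg half_in_strip open_open_strip
      by (intro higher_deriv_sum[of _ _ open_strip] holomorphic_intros) (auto intro: holomorphic_on_subset)
    also have "\<dots> = (\<Sum>n<N. x n * g n (1/2))"
    proof (rule sum.cong)
      fix n
      have "(deriv ^^ k) (\<lambda>z. F z n * g n z) (1/2) =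
          (\<Sum>i = 0..k. of_nat (k choose i) * (deriv ^^ i) (\<lambda>z. F z n) (1/2) * (deriv ^^ (k - i)) (g n) (1/2))"
        using FD(2) holg half_in_strip open_open_strip
        by (intro higher_deriv_mult[of _ open_strip]) (auto intro: holomorphic_on_subset)
      \<comment> \<open>By \<open>van\<close> only the Leibniz term with all k derivatives on F
        survives, so the derivatives of g never matter.\<close>
      also have "\<dots> = (\<Sum>i\<in>{k}. of_nat (k choose i) * (deriv ^^ i) (\<lambda>z. F z n) (1/2) * (deriv ^^ (k - i)) (g n) (1/2))"
        by (rule sum.mono_neutral_right) (auto simp: van)
      finally show "(deriv ^^ k) (\<lambda>z. F z n * g n z) (1/2) = x n * g n (1/2)"
        by (simp add: x_def)
    qed simp
    also have "\<dots> = (\<Sum>n<N. complex_of_real ((cmod (x n))\<^sup>2 / sqrt S))"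
    proof (rule sum.cong)
      fix n
      show "x n * g n (1/2) = complex_of_real ((cmod (x n))\<^sup>2 / sqrt S)"
      proof (cases "x n = 0")
        case False
        have "complex_of_real (2 * l n) * (1 - 1/2) = complex_of_real (l n)"
          by simp
        then have "g n (1/2) = cnj (sgn (x n)) * complex_of_real (exp (l n))"
          using False by (simp only: g_def exp_of_real if_False)
        moreover have "x n * cnj (sgn (x n)) = complex_of_real (cmod (x n))"
          using False by (simp add: sgn_eq complex_norm_square[symmetric] power2_eq_square)
        ultimately show ?thesis
          using expl[OF False] by (simp add: power2_eq_square mult.assoc[symmetric])
      qed (simp add: g0)
    qed simp
    also have "\<dots> = complex_of_real (S / sqrt S)"
      by (simp add: S_def sum_divide_distrib)
    also have "S / sqrt S = sqrt S"
      using S by (simp add: real_div_sqrt)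
    finally have "sqrt S \<le> fact k * 2 ^ k * M"
      using cauchy S by (simp add: power_one_over mult_ac)
    then show ?thesis
      using S by (metis less_imp_le real_sqrt_ge_zero real_sqrt_pow2 power_mono)
  qed simp
  then show ?thesis
    by (simp add: S_def x_def)
qed

section \<open>Explicit paths: scalar cutoffs and extremal powers\<close>

lemma deriv_deriv_eqI:
  assumes S: "open S" "a \<in> S" and f: "\<And>z. z \<in> S \<Longrightarrow> (f has_field_derivative f' z) (at z)"
    and f': "(f' has_field_derivative d) (at a)"
  shows "(deriv ^^ 1) f a = f' a" "(deriv ^^ 2) f a = d"
proof -
  have eq: "deriv f z = f' z" if "z \<in> S" for z
    using f[OF that] by (rule DERIV_imp_deriv)
  then show "(deriv ^^ 1) f a = f' a"
    using S by simp
  have "deriv (deriv f) a = deriv f' a"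
    using S eq by (intro deriv_cong_ev refl) (auto intro: eventually_mono[OF eventually_nhds_in_open[of S a]])
  also have "\<dots> = d"
    using f' by (rule DERIV_imp_deriv)
  finally show "(deriv ^^ 2) f a = d"
    by (simp add: numeral_2_eq_2)
qed

text \<open>The poles 3/2 and -1/2 of the cutoffs are the zeros of 1 - w^2 for w = z - 1/2; they
  keep distance 1/2 from the closed strip.\<close>

lemma strip_denominators:
  assumes "z \<in> strip"
  shows "1/2 \<le> cmod (3/2 - z)" "1/2 \<le> cmod (1/2 + z)" "3/2 - z \<noteq> 0" "1/2 + z \<noteq> 0"
    "\<bar>Im z\<bar> \<le> cmod (3/2 - z)" "\<bar>Im z\<bar> \<le> cmod (1/2 + z)"
proof -
  show 1: "1/2 \<le> cmod (3/2 - z)"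
    using strip_imp_Complex[OF assms] complex_Re_le_cmod[of "3/2 - z"] by simp
  show 2: "1/2 \<le> cmod (1/2 + z)"
    using strip_imp_Complex[OF assms] complex_Re_le_cmod[of "1/2 + z"] by simp
  show "3/2 - z \<noteq> 0" "1/2 + z \<noteq> 0"
    using 1 2 by force+
  show "\<bar>Im z\<bar> \<le> cmod (3/2 - z)" "\<bar>Im z\<bar> \<le> cmod (1/2 + z)"
    using abs_Im_le_cmod[of "3/2 - z"] abs_Im_le_cmod[of "1/2 + z"] by simp_all
qed

text \<open>With \<open>w = z - 1/2\<close>, \<open>odd_cutoff\<close> is \<open>w / (1 - w\<^sup>2) = w + O(w\<^sup>3)\<close> and \<open>even_cutoff\<close> is
  \<open>p (2 - p) = 1 + O(w\<^sup>4)\<close> for \<open>p = 1 / (1 - w\<^sup>2)\<close>; both are bounded on the strip and vanish at infinity.\<close>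

definition odd_cutoff :: "complex \<Rightarrow> complex" where
  "odd_cutoff z = (1 / (3/2 - z) - 1 / (1/2 + z)) / 2"

definition odd_cutoff' :: "complex \<Rightarrow> complex" where
  "odd_cutoff' z = (1 / (3/2 - z)\<^sup>2 + 1 / (1/2 + z)\<^sup>2) / 2"

lemma odd_cutoff_deriv:
  assumes "z \<in> strip"
  shows "(odd_cutoff has_field_derivative odd_cutoff' z) (at z)"
  unfolding odd_cutoff_def[abs_def] odd_cutoff'_def
  using strip_denominators(3,4)[OF assms]
  by (auto intro!: derivative_eq_intros simp: power2_eq_square)

lemma odd_cutoff'_deriv: "(odd_cutoff' has_field_derivative 0) (at (1/2))"
  unfolding odd_cutoff'_def[abs_def]
  by (rule derivative_eq_intros refl | simp)+

lemma odd_cutoff_half: "odd_cutoff (1/2) = 0" "odd_cutoff' (1/2) = 1"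
  by (simp_all add: odd_cutoff_def odd_cutoff'_def)

lemma cont_hol_strip:
  assumes "\<And>z. z \<in> strip \<Longrightarrow> (f has_field_derivative f' z) (at z)"
  shows "continuous_on strip f" "f holomorphic_on open_strip"
proof -
  have "f holomorphic_on strip"
    unfolding holomorphic_on_def field_differentiable_def
    using assms has_field_derivative_at_within by blast
  then show "continuous_on strip f" "f holomorphic_on open_strip"
    using holomorphic_on_imp_continuous_on holomorphic_on_subset open_strip_subset by blast+
qed

text \<open>The first bound makes the cutoff a multiplier of admissible paths; the second is the
  decay along vertical lines that the Calderon space requires.\<close>

lemma odd_cutoff_le:
  assumes "z \<in> strip"
  shows "cmod (odd_cutoff z) \<le> 2" "\<bar>Im z\<bar> * cmod (odd_cutoff z) \<le> 1"
proof -
  note d = strip_denominators[OF assms]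
  have le: "cmod (odd_cutoff z) \<le> (1 / cmod (3/2 - z) + 1 / cmod (1/2 + z)) / 2"
    unfolding odd_cutoff_def norm_divide[of _ 2]
    using norm_triangle_ineq4[of "1 / (3/2 - z)" "1 / (1/2 + z)"] by (simp add: norm_divide)
  have "1 / cmod (3/2 - z) \<le> 2" "1 / cmod (1/2 + z) \<le> 2"
    using d(1,2) by (simp_all add: divide_le_eq)
  then show "cmod (odd_cutoff z) \<le> 2"
    using le by simp
  have "\<bar>Im z\<bar> * cmod (odd_cutoff z) \<le> \<bar>Im z\<bar> * ((1 / cmod (3/2 - z) + 1 / cmod (1/2 + z)) / 2)"
    using le by (intro mult_left_mono) auto
  also have "\<dots> = (\<bar>Im z\<bar> / cmod (3/2 - z) + \<bar>Im z\<bar> / cmod (1/2 + z)) / 2"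
    by (simp add: algebra_simps)
  also have "\<dots> \<le> 1"
  proof -
    have "\<bar>Im z\<bar> / cmod (3/2 - z) \<le> 1" "\<bar>Im z\<bar> / cmod (1/2 + z) \<le> 1"
      using d(3-6) by (simp_all add: divide_le_eq_1)
    then show ?thesis by simp
  qed
  finally show "\<bar>Im z\<bar> * cmod (odd_cutoff z) \<le> 1" .
qed

text \<open>The extremal interpolation path x |x|^(2w) through x at w = z - 1/2 = 0. For nonzero
  \<open>x n\<close> its modulus |x n|^(2 Re z) is 1 on the left line and |x n|^2 on the
  right.\<close>

definition power_path :: "cseq \<Rightarrow> complex \<Rightarrow> cseq" where
  "power_path x z n = (if x n = 0 then 0 else x n * exp (2 * complex_of_real (ln (cmod (x n))) * (z - 1/2)))"

lemma power_path_half [simp]: "power_path x (1/2) n = x n"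
  by (simp add: power_path_def)

lemma power_path_deriv:
  "((\<lambda>z. power_path x z n) has_field_derivative 2 * complex_of_real (ln (cmod (x n))) * power_path x z n) (at z)"
proof (cases "x n = 0")
  case True
  then show ?thesis by (simp add: power_path_def)
next
  case False
  then show ?thesis
    unfolding power_path_def by (auto intro!: derivative_eq_intros)
qed

lemma cmod_power_path:
  assumes "x n \<noteq> 0"
  shows "cmod (power_path x z n) = exp (2 * ln (cmod (x n)) * Re z)"
proof -
  have "cmod (power_path x z n) = exp (ln (cmod (x n))) * exp (2 * ln (cmod (x n)) * (Re z - 1/2))"
    using assms by (simp add: power_path_def norm_mult)
  also have "\<dots> = exp (2 * ln (cmod (x n)) * Re z)"
    by (simp add: exp_add[symmetric] algebra_simps)
  finally show ?thesis .
qed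

text \<open>The left line has modulus at most 1, hence the hypothesis 1 \<le> A; the sum on the
  right line is the sum of squares. In between, the exponent is linear in \<open>Re z\<close> and so
  at most its larger endpoint value.\<close>

lemma admissible_power_path:
  assumes "\<And>N. (\<Sum>n<N. (cmod (x n))\<^sup>2) \<le> A" "1 \<le> A"
  shows "admissible A (power_path x)"
  unfolding admissible_def
proof (intro conjI allI)
  have sq: "exp (2 * ln (cmod (x n))) = (cmod (x n))\<^sup>2" if "x n \<noteq> 0" for n
    using that by (simp add: exp_double)
  fix n
  show "continuous_on strip (\<lambda>z. power_path x z n)" "(\<lambda>z. power_path x z n) holomorphic_on open_strip"
    using cont_hol_strip[OF power_path_deriv] by auto
  have "cmod (power_path x z n) \<le> 1 + (cmod (x n))\<^sup>2" if "z \<in> strip" for z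
  proof (cases "x n = 0")
    case False
    let ?l = "2 * ln (cmod (x n))"
    have "?l * Re z \<le> max 0 ?l"
      using strip_imp_Complex[OF that] mult_left_le[of "Re z" ?l] mult_nonpos_nonneg[of ?l "Re z"]
      by linarith
    then have "exp (?l * Re z) \<le> exp (max 0 ?l)"
      by simp
    also have "\<dots> \<le> 1 + exp ?l"
      by (simp add: max_def)
    finally show ?thesis
      using False by (simp add: cmod_power_path sq)
  qed (simp add: power_path_def)
  then show "\<exists>B. \<forall>z\<in>strip. cmod (power_path x z n) \<le> B"
    by blast
  show "cmod (power_path x (Complex 0 t) n) \<le> A" for t
    using assms(2) by (cases "x n = 0") (simp_all add: cmod_power_path, simp add: power_path_def)
next
  fix t N
  have "cmod (power_path x (Complex 1 t) n) = (cmod (x n))\<^sup>2" for n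
    by (cases "x n = 0") (simp_all add: cmod_power_path exp_double, simp add: power_path_def)
  then show "(\<Sum>n<N. cmod (power_path x (Complex 1 t) n)) \<le> A"
    using assms(1) by simp
qed

text \<open>With \<open>s = \<bar>x\<bar> \<bar>ln \<bar>x\<bar>\<bar>\<close>, either \<open>s \<le> \<bar>y\<bar>\<close>, or the term \<open>y ln \<bar>y\<bar>\<close> cannot compensate
  \<open>x (ln \<bar>x\<bar>)\<^sup>2\<close>: the difference of their moduli is at least \<open>s ln \<bar>ln \<bar>x\<bar>\<bar>\<close>.\<close>

lemma mult_ln_le:
  fixes x y w :: complex
  assumes x: "cmod x \<le> 1" and w: "w = x * (ln (cmod x))\<^sup>2 + y * ln (cmod y)"
  shows "cmod x * \<bar>ln (cmod x)\<bar> \<le> 3 * cmod x + cmod y + cmod w"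
proof (cases "x = 0")
  case False
  define l where "l = - ln (cmod x)"
  define s where "s = cmod x * l"
  have l: "0 \<le> l" and absl: "\<bar>ln (cmod x)\<bar> = l"
    using x False by (auto simp: l_def)
  have "cmod x * \<bar>ln (cmod x)\<bar> = s"
    by (simp add: s_def absl)
  moreover have "s \<le> 3 * cmod x + cmod y + cmod w"
  proof (cases "l \<le> 3 \<or> s \<le> cmod y")
    case True
    then show ?thesis
    proof
      assume "l \<le> 3"
      then have "s \<le> cmod x * 3"
        unfolding s_def by (intro mult_left_mono) auto
      then show ?thesis using norm_ge_zero[of y] norm_ge_zero[of w] by linarith
    next
      assume "s \<le> cmod y"
      then show ?thesis using norm_ge_zero[of x] norm_ge_zero[of w] by linarith
    qed
  next
    case False
    then have l3: "3 < l" and ys: "cmod y < s" by auto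
    have s: "0 < s"
      using \<open>x \<noteq> 0\<close> l3 by (simp add: s_def)
    have lns: "ln s = ln l - l"
      unfolding s_def using \<open>x \<noteq> 0\<close> l3 by (subst ln_mult) (auto simp: l_def)
    \<comment> \<open>The threshold 3 for l is an integer above e, which makes ln l at least
      1.\<close>
    have lnl: "1 \<le> ln l"
      using l3 exp_le by (subst ln_ge_iff) auto
    have lns1: "ln s \<le> -1"
      using ln_le_minus_one[of l] l3 by (simp add: lns)
    \<comment> \<open>On (0, 1/e] the function -t ln t increases, and ln s \<le> -1. Here ln u \<le>
      u - 1 at u = s / |y| replaces the monotonicity argument.\<close>
    have yl: "cmod y * \<bar>ln (cmod y)\<bar> \<le> - s * ln s"
    proof (cases "y = 0")
      case True
      have "s * ln s \<le> 0"
        by (rule mult_nonneg_nonpos) (use s lns1 in linarith)+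
      moreover have "cmod y * \<bar>ln (cmod y)\<bar> = 0"
        using True by simp
      ultimately show ?thesis by linarith
    next
      case False
      then have b: "0 < cmod y" by simp
      have "ln (cmod y) < ln s"
        using b ys s by simp
      then have "\<bar>ln (cmod y)\<bar> = - ln (cmod y)"
        using lns1 by linarith
      also have "\<dots> = - ln s + ln (s / cmod y)"
        using b s by (simp add: ln_div)
      also have "\<dots> \<le> - ln s + (s / cmod y - 1)"
        using ln_le_minus_one[of "s / cmod y"] b s by simp
      finally have "cmod y * \<bar>ln (cmod y)\<bar> \<le> cmod y * (- ln s + (s / cmod y - 1))"
        by (intro mult_left_mono) auto
      also have "\<dots> = cmod y * (- ln s - 1) + s"
        using b by (simp add: field_simps)
      also have "\<dots> \<le> s * (- ln s - 1) + s"
        using ys lns1 by (intro add_right_mono mult_right_mono) auto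
      finally show ?thesis by (simp add: algebra_simps)
    qed
    have "x * (ln (cmod x))\<^sup>2 = w - y * ln (cmod y)"
      by (simp add: w)
    then have "cmod (x * (ln (cmod x))\<^sup>2) \<le> cmod w + cmod (y * ln (cmod y))"
      by (metis norm_triangle_ineq4)
    then have "s * l \<le> cmod w + cmod y * \<bar>ln (cmod y)\<bar>"
      by (simp add: norm_mult norm_power s_def l_def power2_eq_square)
    also have "\<dots> \<le> cmod w + - s * ln s"
      using yl by simp
    \<comment> \<open>Since ln s = ln l - l, the terms s l on both sides cancel and only s ln l is
      left.\<close>
    finally have "s * ln l \<le> cmod w"
      by (simp add: lns algebra_simps)
    moreover have "s * 1 \<le> s * ln l"
      using s lnl by (intro mult_left_mono) auto
    ultimately show ?thesis
      using norm_ge_zero[of x] norm_ge_zero[of y] by linarith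
  qed
  ultimately show ?thesis by simp
qed simp

text \<open>\<open>leading_coefficient_l_two\<close> is applied at orders 0, 1 and 2, to F, G and K
  in turn, each obtained by removing the leading term of its predecessor. The bound is normalised to
  1 because logarithms are not homogeneous and \<open>mult_ln_le\<close> needs |x n| \<le>
  1.\<close>

lemma first_coefficient_unit:
  assumes F: "admissible 1 F" and F2: "\<And>n. (deriv ^^ 2) (\<lambda>z. F z n) (1/2) = 0"
  shows "(\<Sum>n<N. (cmod (deriv (\<lambda>z. F z n) (1/2)))\<^sup>2) \<le> 1000\<^sup>2"
proof -
  define f1 where "f1 n z = deriv (\<lambda>z. F z n) z" for n z
  define x where "x n = F (1/2) n" for n
  define L where "L n = complex_of_real (ln (cmod (x n)))" for n
  define y where "y n = f1 n (1/2) - 2 * L n * x n" for n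
  define l where "l n = complex_of_real (ln (cmod (y n)))" for n
  \<comment> \<open>A coefficient, not the variable z - 1/2: it is -1/4 times the second derivative
    of K at 1/2.\<close>
  define w where "w n = x n * (L n)\<^sup>2 + y n * l n" for n
  let ?E = "power_path x" and ?Y = "power_path y"
  note half = open_open_strip half_in_strip(1)
  have Fd: "((\<lambda>z. F z n) has_field_derivative f1 n z) (at z)" if "z \<in> open_strip" for z n
    unfolding f1_def using admissibleD(2)[OF F] open_open_strip that by (rule holomorphic_derivI)
  have f1d: "(f1 n has_field_derivative 0) (at (1/2))" for n
  proof -
    have "f1 n holomorphic_on open_strip"
      unfolding f1_def using admissibleD(2)[OF F] open_open_strip by (rule holomorphic_deriv)
    then have "(f1 n has_field_derivative deriv (f1 n) (1/2)) (at (1/2))"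
      using half by (rule holomorphic_derivI)
    moreover have "deriv (f1 n) (1/2) = 0"
      using F2[of n] by (simp add: f1_def[abs_def] numeral_2_eq_2)
    ultimately show ?thesis by simp
  qed
  have xb: "(\<Sum>n<N. (cmod (x n))\<^sup>2) \<le> 1" for N
    using leading_coefficient_l_two[OF F, of 0 N] by (simp add: x_def)
  have E: "admissible 1 ?E"
    by (rule admissible_power_path[OF xb]) simp
  let ?G = "\<lambda>z n. F z n - ?E z n"
  have G: "admissible (1 + 1) ?G"
    by (rule admissible_diff[OF F E])
  have G1: "(deriv ^^ 1) (\<lambda>z. ?G z n) (1/2) = y n" for n
  proof -
    have "((\<lambda>z. ?G z n) has_field_derivative y n) (at (1/2))"
      using DERIV_diff[OF Fd[OF half(2)] power_path_deriv] by (simp add: y_def L_def)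
    then show ?thesis
      by (simp add: DERIV_imp_deriv)
  qed
  \<comment> \<open>G vanishes at 1/2, so y is its leading coefficient; with bound 2 and k = 1 this
    gives (2 * 2)^2 = 16.\<close>
  have yb: "(\<Sum>n<N. (cmod (y n))\<^sup>2) \<le> 16" for N
    using leading_coefficient_l_two[OF G, of 1 N] unfolding G1 by (simp add: x_def)
  have Y: "admissible 16 ?Y"
    by (rule admissible_power_path[OF yb]) simp
  \<comment> \<open>The cutoff stands for z - 1/2, which is unbounded on the strip; to second order
    at 1/2 they agree.\<close>
  let ?K = "\<lambda>z n. ?G z n - odd_cutoff z * ?Y z n"
  have K: "admissible (1 + 1 + 2 * 16) ?K"
    by (rule admissible_diff[OF G admissible_mult[OF Y cont_hol_strip[OF odd_cutoff_deriv] odd_cutoff_le(1)]])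
  \<comment> \<open>As F'' vanishes at 1/2, the second derivative consists of -4 x L^2 from the
    power path of x and -4 y l from the cross terms of the product.\<close>
  have K12: "(deriv ^^ 1) (\<lambda>z. ?K z n) (1/2) = 0 \<and> (deriv ^^ 2) (\<lambda>z. ?K z n) (1/2) = - 4 * w n" for n
  proof -
    let ?K' = "\<lambda>z. f1 n z - 2 * L n * ?E z n - (odd_cutoff' z * ?Y z n + (2 * l n * ?Y z n) * odd_cutoff z)"
    have d1: "((\<lambda>z. ?K z n) has_field_derivative ?K' z) (at z)" if "z \<in> open_strip" for z
      unfolding L_def l_def using that open_strip_subset
      by (intro DERIV_diff DERIV_mult Fd power_path_deriv odd_cutoff_deriv) auto
    have d2: "(?K' has_field_derivative
        0 - 2 * L n * (2 * L n * ?E (1/2) n)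
        - ((0 * ?Y (1/2) n + (2 * l n * ?Y (1/2) n) * odd_cutoff' (1/2))
           + ((2 * l n * (2 * l n * ?Y (1/2) n)) * odd_cutoff (1/2)
              + odd_cutoff' (1/2) * (2 * l n * ?Y (1/2) n)))) (at (1/2))"
      unfolding L_def l_def
      by (intro DERIV_diff DERIV_add DERIV_mult DERIV_cmult f1d power_path_deriv odd_cutoff_deriv
          odd_cutoff'_deriv half_in_strip)
    have "?K' (1/2) = 0"
      by (simp add: odd_cutoff_half y_def)
    moreover have "0 - 2 * L n * (2 * L n * ?E (1/2) n)
        - ((0 * ?Y (1/2) n + (2 * l n * ?Y (1/2) n) * odd_cutoff' (1/2))
           + ((2 * l n * (2 * l n * ?Y (1/2) n)) * odd_cutoff (1/2)
              + odd_cutoff' (1/2) * (2 * l n * ?Y (1/2) n))) = - 4 * w n"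
      by (simp add: odd_cutoff_half w_def power2_eq_square algebra_simps)
    ultimately show ?thesis
      using deriv_deriv_eqI[OF half d1 d2] by simp
  qed
  have "(\<Sum>n<N. (cmod (- 4 * w n))\<^sup>2) \<le> (fact 2 * 2 ^ 2 * (1 + 1 + 2 * 16))\<^sup>2"
  proof -
    have "(deriv ^^ j) (\<lambda>z. ?K z n) (1/2) = 0" if "j < 2" for n j
      using that K12[of n] by (cases j) (auto simp: x_def odd_cutoff_half less_Suc_eq numeral_2_eq_2)
    from leading_coefficient_l_two[OF K this, where k = 2 and N = N] show ?thesis
      by (simp only: K12)
  qed
  \<comment> \<open>8 * 34 = 272, and dividing by the factor 4 leaves 68.\<close>
  then have wb: "(\<Sum>n<N. (cmod (w n))\<^sup>2) \<le> 68\<^sup>2"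
    by (simp add: norm_mult power_mult_distrib sum_distrib_left[symmetric] fact_numeral)
  \<comment> \<open>The solution f1 = y + 2 x L and \<open>mult_ln_le\<close> give |f1| \<le> 6|x| +
    3|y| + 2|w|; squaring three terms costs 3, and 108 = 3 * 6^2.\<close>
  have pw: "(cmod (f1 n (1/2)))\<^sup>2 \<le> 108 * ((cmod (x n))\<^sup>2 + (cmod (y n))\<^sup>2 + (cmod (w n))\<^sup>2)" for n
  proof -
    let ?a = "cmod (x n)" and ?b = "cmod (y n)" and ?c = "cmod (w n)"
    have "?a\<^sup>2 \<le> 1"
      using xb[of "Suc n"] sum_nonneg[of "{..<n}" "\<lambda>n. (cmod (x n))\<^sup>2"] by simp
    then have a1: "?a \<le> 1"
      by (simp add: abs_square_le_1)
    have "?a * \<bar>ln ?a\<bar> \<le> 3 * ?a + ?b + ?c"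
      by (rule mult_ln_le[OF a1]) (simp add: w_def L_def l_def)
    moreover have "cmod (f1 n (1/2)) \<le> ?b + 2 * (?a * \<bar>ln ?a\<bar>)"
    proof -
      have "f1 n (1/2) = y n + 2 * (x n * L n)" by (simp add: y_def)
      then show ?thesis
        using norm_triangle_ineq[of "y n" "2 * (x n * L n)"] by (simp add: norm_mult L_def)
    qed
    ultimately have "cmod (f1 n (1/2)) \<le> 6 * ?a + 3 * ?b + 2 * ?c"
      by linarith
    then have "(cmod (f1 n (1/2)))\<^sup>2 \<le> (6 * ?a + 3 * ?b + 2 * ?c)\<^sup>2"
      by (intro power_mono) auto
    also have "\<dots> \<le> 3 * (6 * ?a)\<^sup>2 + 3 * (3 * ?b)\<^sup>2 + 3 * (2 * ?c)\<^sup>2"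
      using sum_squares_bound[of "6 * ?a" "3 * ?b"] sum_squares_bound[of "6 * ?a" "2 * ?c"]
        sum_squares_bound[of "3 * ?b" "2 * ?c"]
      by (simp add: power2_eq_square algebra_simps)
    also have "\<dots> \<le> 108 * (?a\<^sup>2 + ?b\<^sup>2 + ?c\<^sup>2)"
      by (simp add: power_mult_distrib)
    finally show ?thesis .
  qed
  have "(\<Sum>n<N. (cmod (f1 n (1/2)))\<^sup>2) \<le>
      108 * ((\<Sum>n<N. (cmod (x n))\<^sup>2) + (\<Sum>n<N. (cmod (y n))\<^sup>2) + (\<Sum>n<N. (cmod (w n))\<^sup>2))"
    using sum_mono[where K = "{..<N}", OF pw] by (simp add: sum.distrib sum_distrib_left)
  also have "\<dots> \<le> 108 * (1 + 16 + 68\<^sup>2)"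
    by (intro mult_left_mono add_mono xb yb wb) auto
  also have "\<dots> \<le> 1000\<^sup>2" by simp
  finally show ?thesis
    by (simp add: f1_def)
qed

text \<open>The claim itself is homogeneous in F, so dividing F by M reduces it to the unit
  case.\<close>

lemma first_coefficient_l_two:
  assumes F: "admissible M F" and M: "0 < M"
    and F2: "\<And>n. (deriv ^^ 2) (\<lambda>z. F z n) (1/2) = 0"
  shows "(\<Sum>n<N. (cmod (deriv (\<lambda>z. F z n) (1/2)))\<^sup>2) \<le> (1000 * M)\<^sup>2"
proof -
  let ?c = "complex_of_real (1/M)"
  let ?F = "\<lambda>z n. ?c * F z n"
  have d: "(deriv ^^ k) (\<lambda>z. ?F z n) (1/2) = ?c * (deriv ^^ k) (\<lambda>z. F z n) (1/2)" for k n
    using admissibleD(2)[OF F] half_in_strip(1) open_open_strip by (rule higher_deriv_cmult)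
  have "admissible ((1/M) * M) ?F"
    using M by (intro admissible_mult[OF F]) (auto simp: norm_divide)
  then have "admissible 1 ?F"
    using M by simp
  then have "(\<Sum>n<N. (cmod (deriv (\<lambda>z. ?F z n) (1/2)))\<^sup>2) \<le> 1000\<^sup>2"
    by (rule first_coefficient_unit) (simp only: d F2 mult_zero_right)
  moreover have "deriv (\<lambda>z. ?F z n) (1/2) = ?c * deriv (\<lambda>z. F z n) (1/2)" for n
    using d[of 1 n] by simp
  ultimately have "(\<Sum>n<N. (cmod (?c * deriv (\<lambda>z. F z n) (1/2)))\<^sup>2) \<le> 1000\<^sup>2"
    by (simp only:)
  then have "(\<Sum>n<N. (cmod (deriv (\<lambda>z. F z n) (1/2)))\<^sup>2) / M\<^sup>2 \<le> 1000\<^sup>2"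
    using M by (simp add: norm_divide power_divide sum_divide_distrib)
  then show ?thesis
    using M by (simp add: power_mult_distrib divide_le_eq)
qed

subsection \<open>Functions in the Calderon space\<close>

text \<open>Dominated convergence for series (Tannery). The trivial filter is split off because that
  theorem excludes it.\<close>

lemma tendsto_in_l_oneI:
  assumes eps: "summable eps" and f: "\<forall>\<^sub>F t in A. \<forall>n. cmod (f t n) \<le> eps n"
    and l: "\<And>n. cmod (l n) \<le> eps n" and lim: "\<And>n. ((\<lambda>t. f t n) \<longlongrightarrow> l n) A"
  shows "tendsto_in l_one f l A"
proof (cases "A = bot")
  case False
  have "\<forall>\<^sub>F t in A. \<forall>n. norm (cmod (f t n - l n)) \<le> 2 * eps n"
    using f
  proof eventually_elim
    case (elim t)
    show ?case
    proof
      fix n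
      show "norm (cmod (f t n - l n)) \<le> 2 * eps n"
        using elim[rule_format, of n] l[of n] norm_triangle_ineq4[of "f t n" "l n"] by simp
    qed
  qed
  then have bound: "\<forall>\<^sub>F (n, t) in at_top \<times>\<^sub>F A. norm (cmod (f t n - l n)) \<le> 2 * eps n"
    unfolding eventually_prod_filter by (intro exI[of _ "\<lambda>_. True"] exI) auto
  have "((\<lambda>t. cmod (f t n - l n)) \<longlongrightarrow> 0) A" for n
    using lim[of n] by (simp add: LIM_zero_iff tendsto_norm_zero_iff)
  then have "((\<lambda>t. \<Sum>n. cmod (f t n - l n)) \<longlongrightarrow> (\<Sum>n. 0)) A"
    using tannerys_theorem[where a = "\<lambda>n t. cmod (f t n - l n)" and b = "\<lambda>n. 0", OF _ bound _ False] eps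
    by (simp add: summable_mult)
  then show ?thesis
    by (simp add: tendsto_in_def nrm_l_one)
qed (simp add: tendsto_in_def)

text \<open>The null majorant makes all coordinates beyond some N uniformly small; the finitely many
  others converge one by one.\<close>

lemma tendsto_sup_norm:
  assumes eps: "eps \<longlonglongrightarrow> (0::real)" and f: "\<forall>\<^sub>F t in A. \<forall>n. cmod (f t n) \<le> eps n"
    and l: "\<And>n. cmod (l n) \<le> eps n" and lim: "\<And>n. ((\<lambda>t. f t n) \<longlongrightarrow> l n) A" and e: "0 < e"
  shows "\<forall>\<^sub>F t in A. \<forall>n. cmod (f t n - l n) \<le> e"
proof -
  have "\<forall>\<^sub>F n in sequentially. eps n < e / 2"
    using eps e by (intro order_tendstoD) auto
  then obtain N where N: "\<And>n. N \<le> n \<Longrightarrow> eps n < e / 2"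
    unfolding eventually_sequentially by blast
  have "\<forall>\<^sub>F t in A. \<forall>n\<in>{..<N}. dist (f t n) (l n) < e"
    using lim e by (intro eventually_ball_finite ballI tendstoD) auto
  then show ?thesis
    using f
  proof eventually_elim
    case (elim t)
    show ?case
    proof
      fix n
      show "cmod (f t n - l n) \<le> e"
      proof (cases "n < N")
        case True
        then show ?thesis using elim(1) by (force simp: dist_norm)
      next
        case False
        then show ?thesis
          using N[of n] elim(2)[rule_format, of n] l[of n] norm_triangle_ineq4[of "f t n" "l n"] by simp
      qed
    qed
  qed
qed

lemma tendsto_in_sigmaI:
  assumes eps: "eps \<longlonglongrightarrow> (0::real)" and f: "\<forall>\<^sub>F t in A. \<forall>n. cmod (f t n) \<le> eps n"
    and l: "\<And>n. cmod (l n) \<le> eps n" and lim: "\<And>n. ((\<lambda>t. f t n) \<longlongrightarrow> l n) A"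
  shows "tendsto_in sigma_space f l A" "tendsto_in l_infty f l A"
proof -
  have *: "\<forall>\<^sub>F t in A. 0 \<le> nrm sigma_space (f t - l) \<and> nrm sigma_space (f t - l) < e
      \<and> nrm l_infty (f t - l) = nrm sigma_space (f t - l)" if e: "0 < e" for e
  proof -
    have "0 < e / 2" using e by simp
    from tendsto_sup_norm[OF assms this] show ?thesis
    proof eventually_elim
      case (elim t)
      then have le: "\<And>n. cmod ((f t - l) n) \<le> e / 2" by simp
      have "f t - l \<in> carr sigma_space"
        by (rule carr_sigmaI[OF le])
      moreover have "nrm sigma_space (f t - l) \<le> e / 2"
        by (rule nrm_sigma_le[OF le])
      ultimately show ?case
        using e nrm_sigma_nonneg[of "f t - l"] nrm_sigma[of "f t - l"] carr_sigma by auto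
    qed
  qed
  show "tendsto_in sigma_space f l A"
    unfolding tendsto_in_def
  proof (rule tendstoI)
    fix e :: real assume "0 < e"
    from *[OF this] show "\<forall>\<^sub>F t in A. dist (nrm sigma_space (f t - l)) 0 < e"
      by eventually_elim simp
  qed
  show "tendsto_in l_infty f l A"
    unfolding tendsto_in_def
  proof (rule tendstoI)
    fix e :: real assume "0 < e"
    from *[OF this] show "\<forall>\<^sub>F t in A. dist (nrm l_infty (f t - l)) 0 < e"
      by eventually_elim simp
  qed
qed

text \<open>A null majorant \<open>eps\<close> on the strip and a summable majorant
  \<open>del\<close> on the right line reduce all vector-valued limits in the definition to
  coordinatewise ones, and also bound the norm.\<close>

lemma calderonI:
  assumes off: "\<And>z. z \<notin> strip \<Longrightarrow> F z = 0"
    and cont: "\<And>n. continuous_on strip (\<lambda>z. F z n)"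
    and hol: "\<And>n. (\<lambda>z. F z n) holomorphic_on open_strip"
    and eps: "eps \<longlonglongrightarrow> 0" "\<And>n. eps n \<le> M" "\<And>z n. z \<in> strip \<Longrightarrow> cmod (F z n) \<le> eps n"
    and del: "summable del" "suminf del \<le> M" "\<And>t n. cmod (F (Complex 1 t) n) \<le> del n"
    and lim: "\<And>n. ((\<lambda>t. F (Complex 0 t) n) \<longlongrightarrow> 0) at_infinity"
      "\<And>n. ((\<lambda>t. F (Complex 1 t) n) \<longlongrightarrow> 0) at_infinity"
  shows "F \<in> calderon l_infty l_one" "calderon_norm l_infty l_one F \<le> M"
proof -
  have line: "((\<lambda>t. F (Complex r t) n) \<longlongrightarrow> F (Complex r s) n) (at s)" if "0 \<le> r" "r \<le> 1" for r s n
  proof -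
    have "continuous_on UNIV (\<lambda>t. F (Complex r t) n)"
      using that by (intro continuous_on_compose2[OF cont]) (auto simp: strip_def intro!: continuous_intros)
    then show ?thesis
      by (simp add: continuous_on_def)
  qed
  have eps0: "0 \<le> eps n" for n
    using eps(3)[OF half_in_strip(2)] norm_ge_zero order_trans by blast
  have del0: "0 \<le> del n" for n
    using del(3)[of 0 n] norm_ge_zero order_trans by blast
  have bdM: "cmod (F z n) \<le> M" if "z \<in> strip" for z n
    using eps(2)[of n] eps(3)[OF that, of n] by linarith
  have in0: "Complex 0 t \<in> strip" for t
    by (simp add: strip_def)
  have summ: "summable (\<lambda>n. cmod (F (Complex 1 t) n))" for t
    by (rule summable_comparison_test'[OF del(1), of 0]) (simp add: del)
  show "F \<in> calderon l_infty l_one"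
    unfolding calderon_def
  proof (intro CollectI conjI allI impI ballI)
    show "continuous_into sigma_space strip F"
      unfolding continuous_into_def
    proof (intro conjI ballI)
      show "F s \<in> carr sigma_space" if "s \<in> strip" for s
        using bdM[OF that] by (rule carr_sigmaI)
      show "tendsto_in sigma_space F (F s) (at s within strip)" if "s \<in> strip" for s
      proof (rule tendsto_in_sigmaI(1)[OF eps(1)])
        show "\<forall>\<^sub>F t in at s within strip. \<forall>n. cmod (F t n) \<le> eps n"
          unfolding eventually_at_filter using eps(3) by (intro always_eventually) auto
        show "((\<lambda>t. F t n) \<longlongrightarrow> F s n) (at s within strip)" for n
          using cont[of n] that by (simp add: continuous_on_def)
      qed (use eps(3) that in auto)
    qed
    show "\<exists>M. \<forall>z\<in>strip. nrm sigma_space (F z) \<le> M"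
      by (intro exI[of _ M] ballI nrm_sigma_le bdM)
    show "\<exists>d. has_deriv_in sigma_space F d z" if z: "z \<in> open_strip" for z
    proof -
      obtain r where r: "0 < r" "ball z r \<subseteq> open_strip"
        using z open_open_strip open_contains_ball by blast
      have "has_deriv_in sigma_space F (\<lambda>n. deriv (\<lambda>w. F w n) z) z"
      proof (rule has_deriv_in_sigmaI[OF r(1)])
        show "(\<lambda>w. F w n) holomorphic_on ball z r" for n
          using hol r(2) by (rule holomorphic_on_subset)
        show "cmod (F w n) \<le> M" if "w \<in> ball z r" for w n
          using that r(2) open_strip_subset by (intro bdM) blast
      qed
      then show ?thesis by blast
    qed
    show "continuous_into l_infty UNIV (\<lambda>t. F (Complex 0 t))"
      unfolding continuous_into_def
    proof (intro conjI ballI)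
      show "F (Complex 0 s) \<in> carr l_infty" for s
        using bdM[OF in0] by (auto simp: carr_l_infty)
      show "tendsto_in l_infty (\<lambda>t. F (Complex 0 t)) (F (Complex 0 s)) (at s within UNIV)" for s
        by (rule tendsto_in_sigmaI(2)[OF eps(1)]) (use eps(3) in0 line in auto)
    qed
    show "tendsto_in l_infty (\<lambda>t. F (Complex 0 t)) 0 at_infinity"
      by (rule tendsto_in_sigmaI(2)[OF eps(1)]) (use eps(3) in0 lim eps0 in auto)
    show "continuous_into l_one UNIV (\<lambda>t. F (Complex 1 t))"
      unfolding continuous_into_def
    proof (intro conjI ballI)
      show "F (Complex 1 s) \<in> carr l_one" for s
        using summ by (simp add: carr_l_one)
      show "tendsto_in l_one (\<lambda>t. F (Complex 1 t)) (F (Complex 1 s)) (at s within UNIV)" for s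
        by (rule tendsto_in_l_oneI[OF del(1)]) (use del(3) line in auto)
    qed
    show "tendsto_in l_one (\<lambda>t. F (Complex 1 t)) 0 at_infinity"
      by (rule tendsto_in_l_oneI[OF del(1)]) (use del(3) lim del0 in auto)
  qed (use off in auto)
  have "(SUP t. nrm l_infty (F (Complex 0 t))) \<le> M"
    by (intro cSUP_least nrm_l_infty_le bdM in0) auto
  moreover have "(SUP t. nrm l_one (F (Complex 1 t))) \<le> M"
  proof (intro cSUP_least)
    fix t
    have "nrm l_one (F (Complex 1 t)) \<le> suminf del"
      unfolding nrm_l_one using del(1,3) summ by (intro suminf_le) auto
    then show "nrm l_one (F (Complex 1 t)) \<le> M"
      using del(2) by linarith
  qed auto
  ultimately show "calderon_norm l_infty l_one F \<le> M"
    by (simp add: calderon_norm_def)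
qed

section \<open>From the Calderon space to coordinate bounds\<close>

lemma calderon_coord:
  assumes F: "F \<in> calderon l_infty l_one"
  shows "continuous_on strip (\<lambda>z. F z n)" "(\<lambda>z. F z n) holomorphic_on open_strip"
    "\<exists>B. \<forall>z\<in>strip. \<forall>n. cmod (F z n) \<le> B"
proof -
  have carr: "F z \<in> carr sigma_space" if "z \<in> strip" for z
    using F that by (simp add: calderon_def continuous_into_def)
  show "continuous_on strip (\<lambda>z. F z n)"
    unfolding continuous_on_def
  proof
    fix s assume s: "s \<in> strip"
    have "((\<lambda>t. nrm sigma_space (F t - F s)) \<longlongrightarrow> 0) (at s within strip)"
      using F s by (simp add: calderon_def continuous_into_def tendsto_in_def)
    moreover have "\<forall>\<^sub>F t in at s within strip. norm (F t n - F s n) \<le> nrm sigma_space (F t - F s)"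
      unfolding eventually_at_filter
    proof (intro always_eventually allI impI)
      fix t assume "t \<in> strip"
      then show "norm (F t n - F s n) \<le> nrm sigma_space (F t - F s)"
        using cmod_le_nrm_sigma[OF carr_sigma_diff[OF carr carr], of t s n] s by simp
    qed
    ultimately have "((\<lambda>t. F t n - F s n) \<longlongrightarrow> 0) (at s within strip)"
      by (rule Lim_null_comparison[rotated])
    then show "((\<lambda>t. F t n) \<longlongrightarrow> F s n) (at s within strip)"
      by (simp add: LIM_zero_iff)
  qed
  show "(\<lambda>z. F z n) holomorphic_on open_strip"
    unfolding holomorphic_on_open[OF open_open_strip]
  proof
    fix z assume z: "z \<in> open_strip"
    then obtain d where "has_deriv_in sigma_space F d z"
      using F by (auto simp: calderon_def)
    then have "((\<lambda>w. F w n) has_field_derivative d n) (at z)"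
      using open_open_strip z by (rule has_deriv_in_sigma_coord) (use carr open_strip_subset in blast)
    then show "\<exists>f'. ((\<lambda>w. F w n) has_field_derivative f') (at z)"
      by blast
  qed
  obtain B where "\<And>z. z \<in> strip \<Longrightarrow> nrm sigma_space (F z) \<le> B"
    using F by (auto simp: calderon_def)
  then show "\<exists>B. \<forall>z\<in>strip. \<forall>n. cmod (F z n) \<le> B"
    using cmod_le_nrm_sigma[OF carr] by (intro exI[of _ B]) (blast intro: order_trans)
qed

lemma Delta_calderon:
  assumes F: "F \<in> calderon l_infty l_one"
  shows "Delta l_infty l_one k F n = (deriv ^^ k) (\<lambda>w. F w n) (1/2) / fact k"
proof -
  obtain B where "\<And>z n. z \<in> strip \<Longrightarrow> cmod (F z n) \<le> B"
    using calderon_coord(3)[OF F] by blast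
  then have "Delta l_infty l_one k F = (\<lambda>n. (deriv ^^ k) (\<lambda>w. F w n) (1/2) / fact k)"
    using open_strip_subset by (intro Delta_eq[where F = F and B = B] calderon_coord(2)[OF F]) blast
  then show ?thesis
    by simp
qed

text \<open>Without this bound the suprema in \<open>calderon_norm\<close> would be junk values.\<close>

lemma bdd_above_nrm:
  fixes f :: "real \<Rightarrow> cseq"
  assumes tri: "\<And>a b. a \<in> carr X \<Longrightarrow> b \<in> carr X \<Longrightarrow> \<bar>nrm X a - nrm X b\<bar> \<le> nrm X (a - b)"
    and cont: "continuous_into X UNIV f" and lim: "tendsto_in X f 0 at_infinity"
  shows "bdd_above (range (\<lambda>t. nrm X (f t)))"
proof -
  let ?g = "\<lambda>t. nrm X (f t)"
  have "continuous_on UNIV ?g"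
    unfolding continuous_on_def
  proof
    fix s
    have "((\<lambda>t. nrm X (f t - f s)) \<longlongrightarrow> 0) (at s within UNIV)"
      using cont by (simp add: continuous_into_def tendsto_in_def)
    moreover have "\<forall>\<^sub>F t in at s within UNIV. norm (?g t - ?g s) \<le> nrm X (f t - f s)"
      using cont tri by (intro always_eventually) (simp add: continuous_into_def)
    ultimately have "((\<lambda>t. ?g t - ?g s) \<longlongrightarrow> 0) (at s within UNIV)"
      by (rule Lim_null_comparison[rotated])
    then show "(?g \<longlongrightarrow> ?g s) (at s within UNIV)"
      by (simp add: LIM_zero_iff)
  qed
  moreover have "(?g \<longlongrightarrow> 0) at_infinity"
  proof -
    have "f t - 0 = f t" for t
      by (simp add: fun_eq_iff)
    then show ?thesis
      using lim by (simp add: tendsto_in_def)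
  qed
  then have "\<forall>\<^sub>F t in at_infinity. ?g t < 1"
    by (rule order_tendstoD) simp
  then obtain b where b: "\<And>t. b \<le> norm t \<Longrightarrow> ?g t < 1"
    unfolding eventually_at_infinity by blast
  ultimately have "compact (?g ` {-b..b})"
    by (intro compact_continuous_image) (auto intro: continuous_on_subset)
  then have "bdd_above (?g ` {-b..b})"
    by (intro bounded_imp_bdd_above compact_imp_bounded)
  then obtain B where B: "\<forall>t\<in>{-b..b}. ?g t \<le> B"
    by (auto simp: bdd_above_def)
  have "?g t \<le> max B 1" for t
    using b[of t] bspec[OF B, of t] by (cases "b \<le> norm t") (auto simp: le_max_iff_disj abs_if split: if_splits)
  then show ?thesis
    by (auto simp: bdd_above_def)
qed

lemma nrm_l_infty_triangle:
  assumes "a \<in> carr l_infty" "b \<in> carr l_infty"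
  shows "\<bar>nrm l_infty a - nrm l_infty b\<bar> \<le> nrm l_infty (a - b)"
proof -
  have ab: "a - b \<in> carr l_infty"
    using carr_sigma_diff assms by (simp add: carr_sigma)
  have "nrm l_infty a \<le> nrm l_infty b + nrm l_infty (a - b)"
  proof (rule nrm_l_infty_le)
    show "cmod (a n) \<le> nrm l_infty b + nrm l_infty (a - b)" for n
      using cmod_le_nrm_l_infty[OF assms(2), of n] cmod_le_nrm_l_infty[OF ab, of n]
        norm_triangle_ineq[of "b n" "a n - b n"] by simp
  qed
  moreover have "nrm l_infty b \<le> nrm l_infty a + nrm l_infty (a - b)"
  proof (rule nrm_l_infty_le)
    show "cmod (b n) \<le> nrm l_infty a + nrm l_infty (a - b)" for n
      using cmod_le_nrm_l_infty[OF assms(1), of n] cmod_le_nrm_l_infty[OF ab, of n]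
        norm_triangle_ineq4[of "a n" "a n - b n"] by simp
  qed
  ultimately show ?thesis by linarith
qed

lemma nrm_l_one_triangle:
  assumes "a \<in> carr l_one" "b \<in> carr l_one"
  shows "\<bar>nrm l_one a - nrm l_one b\<bar> \<le> nrm l_one (a - b)"
proof -
  note sa = assms(1)[unfolded carr_l_one] and sb = assms(2)[unfolded carr_l_one]
  have sab: "summable (\<lambda>n. cmod (a n - b n))"
    by (rule summable_comparison_test'[OF summable_add[OF sa sb], of 0]) (simp add: norm_triangle_ineq4)
  have "nrm l_one a - nrm l_one b = (\<Sum>n. cmod (a n) - cmod (b n))"
    using sa sb by (simp add: nrm_l_one suminf_diff)
  moreover have "\<bar>\<Sum>n. cmod (a n) - cmod (b n)\<bar> \<le> (\<Sum>n. \<bar>cmod (a n) - cmod (b n)\<bar>)"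
    by (rule summable_rabs, rule summable_comparison_test'[OF sab, of 0]) (simp add: norm_triangle_ineq3)
  moreover have "(\<Sum>n. \<bar>cmod (a n) - cmod (b n)\<bar>) \<le> (\<Sum>n. cmod (a n - b n))"
    by (intro suminf_le sab norm_triangle_ineq3, rule summable_comparison_test'[OF sab, of 0])
      (simp add: norm_triangle_ineq3)
  ultimately show ?thesis
    by (simp add: nrm_l_one)
qed

lemma calderon_imp_admissible:
  assumes F: "F \<in> calderon l_infty l_one" and M: "calderon_norm l_infty l_one F \<le> M"
  shows "admissible M F"
  unfolding admissible_def
proof (intro conjI allI)
  have b0: "bdd_above (range (\<lambda>t. nrm l_infty (F (Complex 0 t))))"
    using F by (intro bdd_above_nrm nrm_l_infty_triangle) (auto simp: calderon_def)
  have b1: "bdd_above (range (\<lambda>t. nrm l_one (F (Complex 1 t))))"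
    using F by (intro bdd_above_nrm nrm_l_one_triangle) (auto simp: calderon_def)
  fix n
  show "continuous_on strip (\<lambda>z. F z n)" "(\<lambda>z. F z n) holomorphic_on open_strip"
    "\<exists>B. \<forall>z\<in>strip. cmod (F z n) \<le> B"
    using calderon_coord[OF F] by blast+
  show "cmod (F (Complex 0 t) n) \<le> M" for t
  proof -
    have "F (Complex 0 t) \<in> carr l_infty"
      using F by (simp add: calderon_def continuous_into_def)
    then have "cmod (F (Complex 0 t) n) \<le> nrm l_infty (F (Complex 0 t))"
      by (rule cmod_le_nrm_l_infty)
    also have "\<dots> \<le> (SUP t. nrm l_infty (F (Complex 0 t)))"
      using b0 by (rule cSUP_upper2) auto
    finally show ?thesis
      using M by (simp add: calderon_norm_def)
  qed
  show "(\<Sum>n<N. cmod (F (Complex 1 t) n)) \<le> M" for t N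
  proof -
    have "F (Complex 1 t) \<in> carr l_one"
      using F by (simp add: calderon_def continuous_into_def)
    then have "(\<Sum>n<N. cmod (F (Complex 1 t) n)) \<le> nrm l_one (F (Complex 1 t))"
      unfolding nrm_l_one by (intro sum_le_suminf) (auto simp: carr_l_one)
    also have "\<dots> \<le> (SUP t. nrm l_one (F (Complex 1 t)))"
      using b1 by (rule cSUP_upper2) auto
    finally show ?thesis
      using M by (simp add: calderon_norm_def)
  qed
qed

lemma l_two_bounded:
  assumes "\<And>N. (\<Sum>n<N. (cmod (x n))\<^sup>2) \<le> C\<^sup>2" "0 \<le> C"
  shows "x \<in> carr l_two" "nrm l_two x \<le> C"
proof -
  have s: "summable (\<lambda>n. (cmod (x n))\<^sup>2)"
    using assms(1) by (intro summableI_nonneg_bounded) auto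
  then show "x \<in> carr l_two"
    by (simp add: l_two_def)
  have "(\<Sum>n. (cmod (x n))\<^sup>2) \<le> C\<^sup>2"
    using s assms(1) by (intro suminf_le_const) auto
  then show "nrm l_two x \<le> C"
    using assms(2) by (simp add: l_two_def real_le_lsqrt)
qed

text \<open>For k = 0 the first derivative is the leading coefficient; for k = 2
  \<open>first_coefficient_l_two\<close> applies.\<close>

lemma ker_Delta_l_two:
  assumes F: "F \<in> ker_Delta l_infty l_one k" and k: "k = 0 \<or> k = 2"
  shows "Delta l_infty l_one 1 F \<in> carr l_two"
    "nrm l_two (Delta l_infty l_one 1 F) \<le> 1000 * calderon_norm l_infty l_one F"
proof -
  let ?x = "Delta l_infty l_one 1 F"
  have Fc: "F \<in> calderon l_infty l_one" and "Delta l_infty l_one k F n = 0" for n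
    using F by (auto simp: ker_Delta_def)
  then have Fk: "(deriv ^^ k) (\<lambda>z. F z n) (1/2) = 0" for n
    using Delta_calderon[OF Fc, of k n] by simp
  have x: "?x n = deriv (\<lambda>z. F z n) (1/2)" for n
    using Delta_calderon[OF Fc, of 1 n] by simp
  \<comment> \<open>A strict bound M is positive even when the norm of F is 0, as the rescaling by
    1/M requires; M then decreases to the norm.\<close>
  have *: "?x \<in> carr l_two \<and> nrm l_two ?x \<le> 1000 * M" if M: "calderon_norm l_infty l_one F < M" for M
  proof -
    have adm: "admissible M F"
      using Fc M by (intro calderon_imp_admissible) auto
    have M0: "0 < M"
      using admissibleD(6)[OF calderon_imp_admissible[OF Fc order_refl]] M by simp
    have "(\<Sum>n<N. (cmod (?x n))\<^sup>2) \<le> (1000 * M)\<^sup>2" for N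
      unfolding x using k
    proof
      assume "k = 0"
      then have "(\<Sum>n<N. (cmod ((deriv ^^ 1) (\<lambda>z. F z n) (1/2)))\<^sup>2) \<le> (fact 1 * 2 ^ 1 * M)\<^sup>2"
        using Fk by (intro leading_coefficient_l_two[OF adm]) simp
      also have "\<dots> \<le> (1000 * M)\<^sup>2"
        using M0 by (intro power_mono) auto
      finally show "(\<Sum>n<N. (cmod (deriv (\<lambda>z. F z n) (1/2)))\<^sup>2) \<le> (1000 * M)\<^sup>2"
        by simp
    next
      assume "k = 2"
      then show "(\<Sum>n<N. (cmod (deriv (\<lambda>z. F z n) (1/2)))\<^sup>2) \<le> (1000 * M)\<^sup>2"
        using Fk by (intro first_coefficient_l_two[OF adm M0]) simp
    qed
    then show ?thesis
      using M0 l_two_bounded[where x = ?x and C = "1000 * M"] by simp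
  qed
  then show "?x \<in> carr l_two"
    using gt_ex[of "calderon_norm l_infty l_one F"] by blast
  have "nrm l_two ?x / 1000 \<le> calderon_norm l_infty l_one F"
  proof (rule dense_ge)
    show "nrm l_two ?x / 1000 \<le> M" if "calderon_norm l_infty l_one F < M" for M
      using *[OF that] by simp
  qed
  then show "nrm l_two ?x \<le> 1000 * calderon_norm l_infty l_one F"
    by simp
qed

subsection \<open>Lifting square-summable sequences\<close>

text \<open>Partial fractions of p = 1 / (1 - w^2) with w = z - 1/2.\<close>

definition inv_one_minus_sq :: "complex \<Rightarrow> complex" where
  "inv_one_minus_sq z = (1 / (3/2 - z) + 1 / (1/2 + z)) / 2"

definition even_cutoff :: "complex \<Rightarrow> complex" where
  "even_cutoff z = inv_one_minus_sq z * (2 - inv_one_minus_sq z)"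

definition inv_one_minus_sq' :: "complex \<Rightarrow> complex" where
  "inv_one_minus_sq' z = (1 / (3/2 - z)\<^sup>2 - 1 / (1/2 + z)\<^sup>2) / 2"

definition even_cutoff' :: "complex \<Rightarrow> complex" where
  "even_cutoff' z = 2 * (inv_one_minus_sq' z * (1 - inv_one_minus_sq z))"

lemma inv_one_minus_sq_deriv:
  assumes "z \<in> strip"
  shows "(inv_one_minus_sq has_field_derivative inv_one_minus_sq' z) (at z)"
  unfolding inv_one_minus_sq_def[abs_def] inv_one_minus_sq'_def
  using strip_denominators(3,4)[OF assms]
  by (auto intro!: derivative_eq_intros simp: power2_eq_square)

lemma inv_one_minus_sq_half: "inv_one_minus_sq (1/2) = 1" "inv_one_minus_sq' (1/2) = 0"
  by (simp_all add: inv_one_minus_sq_def inv_one_minus_sq'_def)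

lemma inv_one_minus_sq'_deriv: "(inv_one_minus_sq' has_field_derivative 2) (at (1/2))"
  unfolding inv_one_minus_sq'_def[abs_def]
  by (rule derivative_eq_intros refl | simp)+

lemma even_cutoff_deriv:
  assumes "z \<in> strip"
  shows "(even_cutoff has_field_derivative even_cutoff' z) (at z)"
  unfolding even_cutoff_def[abs_def] even_cutoff'_def
  by (rule derivative_eq_intros inv_one_minus_sq_deriv[OF assms] refl)+ (simp add: algebra_simps)

text \<open>Both factors p' and 1 - p vanish at 1/2, hence so does the derivative of their
  product.\<close>

lemma even_cutoff'_deriv: "(even_cutoff' has_field_derivative 0) (at (1/2))"
  unfolding even_cutoff'_def[abs_def]
  by (rule derivative_eq_intros inv_one_minus_sq_deriv inv_one_minus_sq'_deriv half_in_strip refl)+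
     (simp add: inv_one_minus_sq_half)

lemma even_cutoff_half: "even_cutoff (1/2) = 1" "even_cutoff' (1/2) = 0"
  by (simp_all add: even_cutoff_def even_cutoff'_def inv_one_minus_sq_half)

lemma even_cutoff_le:
  assumes "z \<in> strip"
  shows "cmod (even_cutoff z) \<le> 8" "\<bar>Im z\<bar> * cmod (even_cutoff z) \<le> 4"
proof -
  note d = strip_denominators[OF assms]
  let ?p = "inv_one_minus_sq z"
  have le: "cmod ?p \<le> (1 / cmod (3/2 - z) + 1 / cmod (1/2 + z)) / 2"
    unfolding inv_one_minus_sq_def norm_divide[of _ 2]
    using norm_triangle_ineq[of "1 / (3/2 - z)" "1 / (1/2 + z)"] by (simp add: norm_divide)
  have "1 / cmod (3/2 - z) \<le> 2" "1 / cmod (1/2 + z) \<le> 2"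
    using d(1,2) by (simp_all add: divide_le_eq)
  then have p2: "cmod ?p \<le> 2"
    using le by simp
  then have q: "cmod (2 - ?p) \<le> 4"
    using norm_triangle_ineq4[of 2 ?p] by simp
  have "cmod (even_cutoff z) \<le> 2 * 4"
    unfolding even_cutoff_def norm_mult using p2 q by (intro mult_mono) auto
  then show "cmod (even_cutoff z) \<le> 8" by simp
  have "\<bar>Im z\<bar> * cmod ?p \<le> \<bar>Im z\<bar> * ((1 / cmod (3/2 - z) + 1 / cmod (1/2 + z)) / 2)"
    using le by (intro mult_left_mono) auto
  also have "\<dots> = (\<bar>Im z\<bar> / cmod (3/2 - z) + \<bar>Im z\<bar> / cmod (1/2 + z)) / 2"
    by (simp add: algebra_simps)
  also have "\<dots> \<le> 1"
  proof -
    have "\<bar>Im z\<bar> / cmod (3/2 - z) \<le> 1" "\<bar>Im z\<bar> / cmod (1/2 + z) \<le> 1"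
      using d(3-6) by (simp_all add: divide_le_eq_1)
    then show ?thesis by simp
  qed
  finally have "(\<bar>Im z\<bar> * cmod ?p) * cmod (2 - ?p) \<le> 1 * 4"
    using q by (intro mult_mono) auto
  then show "\<bar>Im z\<bar> * cmod (even_cutoff z) \<le> 4"
    by (simp add: even_cutoff_def norm_mult)
qed

section \<open>Tails of square sums and the logarithmic weight\<close>

definition sq_tail :: "cseq \<Rightarrow> nat \<Rightarrow> real" where
  "sq_tail x n = (\<Sum>k. (cmod (x (k + n)))\<^sup>2)"

text \<open>\<open>log_weight x n\<close> is \<open>ln q\<^sub>n\<close> for \<open>q\<^sub>n = \<bar>x n\<bar> / (e sqrt (sq_tail x n)) \<le> 1 / e\<close>. The usual choice
  \<open>q\<^sub>n = \<bar>x n\<bar> / \<parallel>x\<parallel>\<close> has boundary values that neither lie in \<open>c\<^sub>0\<close> nor are continuous into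
  \<open>\<ell>\<^sub>\<infinity>\<close> on \<open>Re z = 0\<close>; the slowly growing factor \<open>1 / sqrt (sq_tail x n)\<close> repairs both.\<close>

definition log_weight :: "cseq \<Rightarrow> nat \<Rightarrow> real" where
  "log_weight x n = ln (cmod (x n)) - ln (sqrt (sq_tail x n)) - 1"

lemma l_two_sq_tail:
  assumes "x \<in> carr l_two"
  shows "sq_tail x n = (cmod (x n))\<^sup>2 + sq_tail x (Suc n)" "0 \<le> sq_tail x n"
    "(cmod (x n))\<^sup>2 \<le> sq_tail x n" "sq_tail x n \<le> sq_tail x 0"
    "sqrt (sq_tail x 0) = nrm l_two x" "sq_tail x \<longlonglongrightarrow> 0"
proof -
  have s: "summable (\<lambda>k. (cmod (x k))\<^sup>2)"
    using assms by (simp add: l_two_def)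
  then have sn: "summable (\<lambda>k. (cmod (x (k + n)))\<^sup>2)" for n
    by (rule summable_ignore_initial_segment)
  have step: "sq_tail x n = (cmod (x n))\<^sup>2 + sq_tail x (Suc n)" for n
    using suminf_split_head[OF sn[of n]] by (simp add: sq_tail_def)
  have nonneg: "0 \<le> sq_tail x n" for n
    unfolding sq_tail_def by (intro suminf_nonneg sn) auto
  show "sq_tail x n = (cmod (x n))\<^sup>2 + sq_tail x (Suc n)" "0 \<le> sq_tail x n"
    by (rule step, rule nonneg)
  show "(cmod (x n))\<^sup>2 \<le> sq_tail x n"
    using step[of n] nonneg[of "Suc n"] by simp
  have "decseq (sq_tail x)"
  proof (rule decseq_SucI)
    show "sq_tail x (Suc n) \<le> sq_tail x n" for n
      using step[of n] zero_le_power2[of "cmod (x n)"] by linarith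
  qed
  then show "sq_tail x n \<le> sq_tail x 0"
    by (auto simp: decseq_def)
  show "sqrt (sq_tail x 0) = nrm l_two x"
    by (simp add: sq_tail_def l_two_def)
  have "sq_tail x = (\<lambda>n. suminf (\<lambda>k. (cmod (x k))\<^sup>2) - (\<Sum>k<n. (cmod (x k))\<^sup>2))"
    by (simp add: fun_eq_iff sq_tail_def suminf_minus_initial_segment[OF s])
  moreover have "\<dots> \<longlonglongrightarrow> suminf (\<lambda>k. (cmod (x k))\<^sup>2) - suminf (\<lambda>k. (cmod (x k))\<^sup>2)"
    by (intro tendsto_diff tendsto_const summable_LIMSEQ[OF s])
  ultimately show "sq_tail x \<longlonglongrightarrow> 0"
    by simp
qed

text \<open>The two exponential identities are the moduli of \<open>x e^(2 l w)\<close> on the left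
  and right boundary lines; the bound -1 keeps 1 / l at modulus at most 1.\<close>

lemma log_weight:
  assumes x: "x \<in> carr l_two" and n: "x n \<noteq> 0"
  shows "0 < sqrt (sq_tail x n)" "log_weight x n \<le> -1"
    "cmod (x n) * exp (- log_weight x n) = exp 1 * sqrt (sq_tail x n)"
    "cmod (x n) * exp (log_weight x n) = (cmod (x n))\<^sup>2 / sqrt (sq_tail x n) / exp 1"
proof -
  have "0 < (cmod (x n))\<^sup>2"
    using n by simp
  then have pos: "0 < sq_tail x n"
    using l_two_sq_tail(3)[OF x, of n] by linarith
  then show *: "0 < sqrt (sq_tail x n)"
    by simp
  have "cmod (x n) \<le> sqrt (sq_tail x n)"
    using l_two_sq_tail(3)[OF x] by (rule real_le_rsqrt)
  then show "log_weight x n \<le> -1"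
    using n * by (simp add: log_weight_def del: real_sqrt_gt_0_iff ln_sqrt)
  have "0 < cmod (x n)"
    using n by simp
  then have exp_w: "exp (log_weight x n) = cmod (x n) / sqrt (sq_tail x n) / exp 1"
    by (simp only: log_weight_def exp_diff exp_ln *)
  show "cmod (x n) * exp (- log_weight x n) = exp 1 * sqrt (sq_tail x n)"
    using n by (simp add: exp_minus exp_w)
  show "cmod (x n) * exp (log_weight x n) = (cmod (x n))\<^sup>2 / sqrt (sq_tail x n) / exp 1"
    by (simp add: exp_w power2_eq_square)
qed

text \<open>With r the square root of the tail, |x n|^2 is a difference of consecutive r^2, at most
  2 r(n) (r(n) - r(n+1)). Dividing by r(n) leaves a telescoping sum.\<close>

lemma sum_sq_div_sqrt_tail:
  assumes x: "x \<in> carr l_two"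
  shows "(\<Sum>n<N. (cmod (x n))\<^sup>2 / sqrt (sq_tail x n)) \<le> 2 * nrm l_two x"
proof -
  note T = l_two_sq_tail[OF x]
  let ?r = "\<lambda>n. sqrt (sq_tail x n)"
  have "(cmod (x n))\<^sup>2 / ?r n \<le> 2 * (?r n - ?r (Suc n))" for n
  proof (cases "x n = 0")
    case True
    then show ?thesis using T(1)[of n] by simp
  next
    case False
    have r: "0 < ?r n" "0 \<le> ?r (Suc n)" "?r (Suc n) \<le> ?r n"
      using log_weight(1)[OF x False] T(1)[of n] T(2) by auto
    have "(cmod (x n))\<^sup>2 = (?r n)\<^sup>2 - (?r (Suc n))\<^sup>2"
      using T(1)[of n] T(2) by simp
    also have "\<dots> = (?r n - ?r (Suc n)) * (?r n + ?r (Suc n))"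
      by (simp add: power2_eq_square algebra_simps)
    also have "\<dots> \<le> (?r n - ?r (Suc n)) * (2 * ?r n)"
      using r by (intro mult_left_mono) auto
    also have "\<dots> = 2 * (?r n - ?r (Suc n)) * ?r n"
      by simp
    finally show ?thesis
      using r(1) by (simp only: pos_divide_le_eq)
  qed
  then have "(\<Sum>n<N. (cmod (x n))\<^sup>2 / ?r n) \<le> (\<Sum>n<N. 2 * (?r n - ?r (Suc n)))"
    by (rule sum_mono)
  also have "\<dots> = 2 * (?r 0 - ?r N)"
    using sum_lessThan_telescope'[of ?r N] by (simp only: sum_distrib_left[symmetric])
  also have "\<dots> \<le> 2 * nrm l_two x"
    using T(2)[of N] T(5) by simp
  finally show ?thesis .
qed

text \<open>To second order at w = 0 this is x e^(2lw) (c + d w), one family for both kernels. It is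
  cut to 0 off the strip as \<open>calderon\<close> prescribes.\<close>

definition lifting :: "(nat \<Rightarrow> complex) \<Rightarrow> complex \<Rightarrow> cseq \<Rightarrow> complex \<Rightarrow> cseq" where
  "lifting c d x z n = (if z \<in> strip \<and> x n \<noteq> 0
     then x n * exp (2 * complex_of_real (log_weight x n) * (z - 1/2)) * (c n * even_cutoff z + d * odd_cutoff z)
     else 0)"

lemma lifting_calderon:
  fixes x :: cseq and c :: "nat \<Rightarrow> complex" and d :: complex
  assumes x: "x \<in> carr l_two" and c: "\<And>n. x n \<noteq> 0 \<Longrightarrow> cmod (c n) \<le> 1" and d: "cmod d \<le> 1"
  shows "lifting c d x \<in> calderon l_infty l_one"
    "calderon_norm l_infty l_one (lifting c d x) \<le> 30 * nrm l_two x"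
    "Delta l_infty l_one 0 (lifting c d x) n = (if x n = 0 then 0 else c n * x n)"
    "Delta l_infty l_one 1 (lifting c d x) n = (if x n = 0 then 0 else (2 * log_weight x n * c n + d) * x n)"
    "Delta l_infty l_one 2 (lifting c d x) n
      = (if x n = 0 then 0 else 2 * log_weight x n * (log_weight x n * c n + d) * x n)"
proof -
  note T = l_two_sq_tail[OF x] and W = log_weight[OF x]
  let ?F = "lifting c d x"
  let ?r = "\<lambda>n. sqrt (sq_tail x n)"
  define u where "u n z = c n * even_cutoff z + d * odd_cutoff z" for n z
  define u' where "u' n z = c n * even_cutoff' z + d * odd_cutoff' z" for n z
  define E where "E n z = x n * exp (2 * complex_of_real (log_weight x n) * (z - 1/2))" for n z
  have F_eq: "?F z n = E n z * u n z" if "x n \<noteq> 0" "z \<in> strip" for z n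
    using that by (simp add: lifting_def E_def u_def)
  have F_0: "?F z n = 0" if "x n = 0" for z n
    using that by (simp add: lifting_def)
  have Ed: "(E n has_field_derivative 2 * complex_of_real (log_weight x n) * E n z) (at z)" for n z
    unfolding E_def by (auto intro!: derivative_eq_intros)
  have ud: "(u n has_field_derivative u' n z) (at z)" if "z \<in> strip" for n z
    unfolding u_def u'_def using that
    by (intro DERIV_add DERIV_cmult even_cutoff_deriv odd_cutoff_deriv)
  have u'd: "(u' n has_field_derivative c n * 0 + d * 0) (at (1/2))" for n
    unfolding u'_def by (intro DERIV_add DERIV_cmult even_cutoff'_deriv odd_cutoff'_deriv)
  have nE: "cmod (E n z) = cmod (x n) * exp (log_weight x n * (2 * Re z - 1))" for n z
    by (simp add: E_def norm_mult algebra_simps)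
  \<comment> \<open>The weight is negative, so the modulus is largest on the left line, where it is
    a multiple of the square root of the tail.\<close>
  have E_le: "cmod (E n z) \<le> exp 1 * ?r n" if "x n \<noteq> 0" "z \<in> strip" for n z
  proof -
    have "log_weight x n * (2 * Re z - 1) \<le> log_weight x n * (- 1)"
      using W(2)[OF that(1)] strip_imp_Complex[OF that(2)] by (intro mult_left_mono_neg) auto
    then have "cmod (E n z) \<le> cmod (x n) * exp (- log_weight x n)"
      unfolding nE by (intro mult_left_mono) auto
    then show ?thesis
      using W(3)[OF that(1)] by simp
  qed
  have E_1: "cmod (E n (Complex 1 t)) = (cmod (x n))\<^sup>2 / ?r n / exp 1" if "x n \<noteq> 0" for n t
    using W(4)[OF that] by (simp add: nE)
  have u_le: "cmod (u n z) \<le> 10" "\<bar>Im z\<bar> * cmod (u n z) \<le> 5" if "x n \<noteq> 0" "z \<in> strip" for n z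
  proof -
    have "cmod (u n z) \<le> cmod (c n) * cmod (even_cutoff z) + cmod d * cmod (odd_cutoff z)"
      unfolding u_def norm_mult[symmetric] by (rule norm_triangle_ineq)
    also have "\<dots> \<le> 1 * cmod (even_cutoff z) + 1 * cmod (odd_cutoff z)"
      using c[OF that(1)] d by (intro add_mono mult_right_mono) auto
    finally have le: "cmod (u n z) \<le> cmod (even_cutoff z) + cmod (odd_cutoff z)"
      by simp
    then show "cmod (u n z) \<le> 10"
      using even_cutoff_le(1)[OF that(2)] odd_cutoff_le(1)[OF that(2)] by simp
    have "\<bar>Im z\<bar> * cmod (u n z) \<le> \<bar>Im z\<bar> * (cmod (even_cutoff z) + cmod (odd_cutoff z))"
      using le by (intro mult_left_mono) auto
    then show "\<bar>Im z\<bar> * cmod (u n z) \<le> 5"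
      using even_cutoff_le(2)[OF that(2)] odd_cutoff_le(2)[OF that(2)] by (simp add: algebra_simps)
  qed
  \<comment> \<open>The factor 10 = 8 + 2 bounds the cutoff combination u; \<open>eps\<close> tends
    to 0 with the tails, and \<open>del\<close> is summable by telescoping.\<close>
  define eps where "eps n = exp 1 * ?r n * 10" for n
  define del where "del n = (cmod (x n))\<^sup>2 / ?r n / exp 1 * 10" for n
  have F_le: "cmod (?F z n) \<le> eps n" if "z \<in> strip" for z n
  proof (cases "x n = 0")
    case True
    then show ?thesis using T(2) by (simp add: F_0 eps_def)
  next
    case False
    then show ?thesis
      unfolding F_eq[OF False that] norm_mult eps_def using E_le u_le that T(2)
      by (intro mult_mono) auto
  qed
  have F_decay: "\<bar>t\<bar> * cmod (?F (Complex r t) n) \<le> exp 1 * ?r n * 5" if "0 \<le> r" "r \<le> 1" for r t n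
  proof (cases "x n = 0")
    case True
    then show ?thesis using T(2) by (simp add: F_0)
  next
    case False
    have z: "Complex r t \<in> strip"
      using that by (simp add: strip_def)
    have "cmod (E n (Complex r t)) * (\<bar>Im (Complex r t)\<bar> * cmod (u n (Complex r t))) \<le> exp 1 * ?r n * 5"
      using E_le[OF False z] u_le(2)[OF False z] T(2) by (intro mult_mono) auto
    then show ?thesis
      unfolding F_eq[OF False z] norm_mult by (simp add: mult_ac)
  qed
  have lim: "((\<lambda>t. ?F (Complex r t) n) \<longlongrightarrow> 0) at_infinity" if "0 \<le> r" "r \<le> 1" for r n
  proof (rule Lim_null_comparison)
    show "\<forall>\<^sub>F t in at_infinity. cmod (?F (Complex r t) n) \<le> exp 1 * ?r n * 5 / norm t"
      unfolding eventually_at_infinity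
    proof (intro exI[of _ 1] allI impI)
      fix t :: real assume "1 \<le> norm t"
      then show "cmod (?F (Complex r t) n) \<le> exp 1 * ?r n * 5 / norm t"
        using F_decay[OF that, of t n] by (simp add: pos_le_divide_eq mult_ac)
    qed
    show "((\<lambda>t::real. exp 1 * ?r n * 5 / norm t) \<longlongrightarrow> 0) at_infinity"
      by (intro tendsto_divide_0[OF tendsto_const] filterlim_at_top_imp_at_infinity filterlim_norm_at_top)
  qed
  \<comment> \<open>With e \<le> 3 the constant 30 dominates \<open>eps\<close>; the sum of
    \<open>del\<close> stays below 20 since 1/e \<le> 1.\<close>
  have e3: "exp (1::real) \<le> 3" by (rule exp_le)
  have nn: "0 \<le> nrm l_two x"
    using T(2,5) by (metis real_sqrt_ge_zero)
  have "\<And>N. (\<Sum>n<N. del n) \<le> 20 * nrm l_two x"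
  proof -
    fix N
    have "(\<Sum>n<N. del n) = (\<Sum>n<N. (cmod (x n))\<^sup>2 / ?r n) * (10 / exp 1)"
      unfolding sum_distrib_right del_def by (intro sum.cong) simp_all
    also have "\<dots> \<le> (2 * nrm l_two x) * 10"
      using nn by (intro mult_mono sum_sq_div_sqrt_tail[OF x]) (auto simp: divide_le_eq)
    finally show "(\<Sum>n<N. del n) \<le> 20 * nrm l_two x" by simp
  qed
  moreover have "0 \<le> del n" for n
    using T(2) by (simp add: del_def)
  ultimately have del: "summable del" "suminf del \<le> 20 * nrm l_two x"
    by (auto intro!: summableI_nonneg_bounded suminf_le_const)
  have Fd: "((\<lambda>z. E n z * u n z) has_field_derivative
      2 * complex_of_real (log_weight x n) * E n z * u n z + u' n z * E n z) (at z)" if "z \<in> strip" for n z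
    using that by (intro DERIV_mult Ed ud)
  have G: "continuous_on strip (\<lambda>z. E n z * u n z)" "(\<lambda>z. E n z * u n z) holomorphic_on open_strip" for n
    using cont_hol_strip[OF Fd] by auto
  have cont: "continuous_on strip (\<lambda>z. ?F z n)" for n
    using G(1)[of n] by (cases "x n = 0") (simp_all add: F_0 F_eq cong: continuous_on_cong)
  have hol: "(\<lambda>z. ?F z n) holomorphic_on open_strip" for n
  proof (cases "x n = 0")
    case False
    show ?thesis
      by (rule holomorphic_transform[OF G(2)[of n]]) (use False F_eq open_strip_subset in auto)
  qed (simp add: F_0)
  have off: "?F z = 0" if "z \<notin> strip" for z
    using that by (simp add: lifting_def fun_eq_iff)
  have eps0: "eps \<longlonglongrightarrow> 0"
    using tendsto_real_sqrt[OF T(6)] unfolding eps_def by (auto intro!: tendsto_eq_intros)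
  have eps_le: "eps n \<le> 30 * nrm l_two x" for n
  proof -
    have "exp 1 * ?r n \<le> 3 * nrm l_two x"
      using e3 T(2) T(4)[of n] T(5)[symmetric] by (intro mult_mono) auto
    then show ?thesis
      by (simp add: eps_def)
  qed
  have del_le: "suminf del \<le> 30 * nrm l_two x"
    using del(2) nn by simp
  have F_1: "cmod (?F (Complex 1 t) n) \<le> del n" for t n
  proof (cases "x n = 0")
    case True
    then show ?thesis by (simp add: F_0 del_def)
  next
    case False
    have z: "Complex 1 t \<in> strip"
      by (simp add: strip_def)
    show ?thesis
      unfolding F_eq[OF False z] norm_mult del_def E_1[OF False]
      using u_le(1)[OF False z] T(2) by (intro mult_left_mono) auto
  qed
  have lim01: "((\<lambda>t. ?F (Complex 0 t) n) \<longlongrightarrow> 0) at_infinity" "((\<lambda>t. ?F (Complex 1 t) n) \<longlongrightarrow> 0) at_infinity" for n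
    by (rule lim; simp)+
  note calderon = calderonI[where F = ?F and eps = eps and del = del and M = "30 * nrm l_two x",
      OF off cont hol eps0 eps_le F_le del(1) del_le F_1 lim01]
  show "?F \<in> calderon l_infty l_one"
    by (rule calderon)
  show "calderon_norm l_infty l_one ?F \<le> 30 * nrm l_two x"
    by (rule calderon)
  \<comment> \<open>Derivatives, not Taylor coefficients: the outer 2 in the second one cancels
    against \<open>fact 2\<close> in \<open>Delta\<close>.\<close>
  have D: "?F (1/2) n = c n * x n \<and>
      (deriv ^^ 1) (\<lambda>z. ?F z n) (1/2) = (2 * log_weight x n * c n + d) * x n \<and>
      (deriv ^^ 2) (\<lambda>z. ?F z n) (1/2) = 2 * (2 * log_weight x n * (log_weight x n * c n + d) * x n)"
    if n: "x n \<noteq> 0" for n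
  proof -
    let ?l = "complex_of_real (log_weight x n)"
    have half: "E n (1/2) = x n" "u n (1/2) = c n" "u' n (1/2) = d"
      by (simp_all add: E_def u_def u'_def even_cutoff_half odd_cutoff_half)
    have d1: "((\<lambda>z. ?F z n) has_field_derivative 2 * ?l * E n z * u n z + u' n z * E n z) (at z)"
      if "z \<in> open_strip" for z
      by (rule has_field_derivative_transform_within_open[OF Fd open_open_strip that])
        (use that n F_eq open_strip_subset in auto)
    have d2: "((\<lambda>z. 2 * ?l * E n z * u n z + u' n z * E n z) has_field_derivative
        (2 * ?l * (2 * ?l * E n (1/2))) * u n (1/2) + u' n (1/2) * (2 * ?l * E n (1/2))
        + ((c n * 0 + d * 0) * E n (1/2) + 2 * ?l * E n (1/2) * u' n (1/2))) (at (1/2))"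
      by (intro DERIV_add DERIV_mult DERIV_cmult Ed ud u'd half_in_strip)
    show ?thesis
      using deriv_deriv_eqI[OF open_open_strip half_in_strip(1) d1 d2] F_eq[OF n half_in_strip(2)] half
      by (simp add: algebra_simps)
  qed
  have D0: "(deriv ^^ k) (\<lambda>z. ?F z n) (1/2) = 0" if "x n = 0" for k n
    unfolding F_0[OF that] by (cases k) (simp_all add: higher_deriv_const)
  note De = Delta_calderon[OF calderon(1)]
  show "Delta l_infty l_one 0 ?F n = (if x n = 0 then 0 else c n * x n)"
    using D[of n] F_0[of n] De[of 0 n] by simp
  show "Delta l_infty l_one 1 ?F n = (if x n = 0 then 0 else (2 * log_weight x n * c n + d) * x n)"
    using D[of n] D0[of n 1] De[of 1 n] by simp
  show "Delta l_infty l_one 2 ?F n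
      = (if x n = 0 then 0 else 2 * log_weight x n * (log_weight x n * c n + d) * x n)"
  proof (cases "x n = 0")
    case True
    then show ?thesis
      using D0[OF True, of 2] De[of 2 n] by simp
  next
    case False
    have "Delta l_infty l_one 2 ?F n = (deriv ^^ 2) (\<lambda>z. ?F z n) (1/2) / fact 2"
      by (rule De)
    also have "\<dots> = 2 * (2 * log_weight x n * (log_weight x n * c n + d) * x n) / 2"
      using D[OF False] by (simp only: fact_2)
    also have "\<dots> = 2 * log_weight x n * (log_weight x n * c n + d) * x n"
      by (rule nonzero_mult_div_cancel_left) simp
    finally show ?thesis
      using False by (simp only: if_False)
  qed
qed

lemma l_two_lifting:
  assumes x: "x \<in> carr l_two" and k: "k = 0 \<or> k = 2"
  shows "\<exists>F\<in>ker_Delta l_infty l_one k. Delta l_infty l_one 1 F = x \<and>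
           calderon_norm l_infty l_one F \<le> 30 * nrm l_two x"
  using k
proof
  assume k: "k = 0"
  let ?F = "lifting (\<lambda>n. 0) 1 x"
  have *: "?F \<in> calderon l_infty l_one" "calderon_norm l_infty l_one ?F \<le> 30 * nrm l_two x"
    "Delta l_infty l_one 0 ?F n = 0" "Delta l_infty l_one 1 ?F n = x n" for n
    using lifting_calderon[OF x, of "\<lambda>n. 0" 1] by auto
  then have "?F \<in> ker_Delta l_infty l_one k" "Delta l_infty l_one 1 ?F = x"
    unfolding ker_Delta_def k by (auto simp: fun_eq_iff)
  then show ?thesis
    using *(2) by blast
next
  assume k: "k = 2"
  \<comment> \<open>With c = 1 / l and d = -1, the second coefficient contains l c + d = 0 while the
    first has 2 l c + d = 1.\<close>
  let ?c = "\<lambda>n. complex_of_real (1 / log_weight x n)"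
  let ?F = "lifting ?c (-1) x"
  have l: "log_weight x n \<le> -1" if "x n \<noteq> 0" for n
    using log_weight(2)[OF x that] .
  have c: "cmod (?c n) \<le> 1" if "x n \<noteq> 0" for n
  proof -
    have "1 \<le> \<bar>log_weight x n\<bar>"
      using l[OF that] by linarith
    then show ?thesis
      by (simp only: norm_of_real abs_divide abs_one divide_le_eq_1) auto
  qed
  have "Delta l_infty l_one 2 ?F n = 0" "Delta l_infty l_one 1 ?F n = x n" for n
    using lifting_calderon(4,5)[of x ?c "-1" n, OF x c] l[of n] by (cases "x n = 0"; auto)+
  then have "?F \<in> ker_Delta l_infty l_one k" "Delta l_infty l_one 1 ?F = x"
    unfolding ker_Delta_def k using lifting_calderon(1)[of x ?c "-1", OF x c] by (auto simp: fun_eq_iff)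
  then show ?thesis
    using lifting_calderon(2)[of x ?c "-1", OF x c] by auto
qed

section \<open>Comparison of the quotient norms with the norm of l_2\<close>

lemma image_space_l_two:
  assumes k: "k = 0 \<or> k = 2"
  defines "X \<equiv> image_space l_infty l_one (Delta l_infty l_one 1) (ker_Delta l_infty l_one k)"
  shows "carr X = carr l_two" "x \<in> carr l_two \<Longrightarrow> nrm X x \<le> 30 * nrm l_two x"
    "x \<in> carr l_two \<Longrightarrow> nrm l_two x \<le> 1000 * nrm X x"
proof -
  show "carr X = carr l_two"
    using ker_Delta_l_two(1)[OF _ k] l_two_lifting[OF _ k] by (force simp: X_def image_space_def)
  assume x: "x \<in> carr l_two"
  let ?N = "{calderon_norm l_infty l_one F | F. F \<in> ker_Delta l_infty l_one k \<and> Delta l_infty l_one 1 F = x}"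
  have nX: "nrm X x = Inf ?N"
    by (simp add: X_def image_space_def)
  obtain F where F: "F \<in> ker_Delta l_infty l_one k" "Delta l_infty l_one 1 F = x"
      "calderon_norm l_infty l_one F \<le> 30 * nrm l_two x"
    using l_two_lifting[OF x k] by blast
  have low: "nrm l_two x / 1000 \<le> s" if s: "s \<in> ?N" for s
  proof -
    obtain G where G: "s = calderon_norm l_infty l_one G" "G \<in> ker_Delta l_infty l_one k"
        "Delta l_infty l_one 1 G = x"
      using s by blast
    show ?thesis
      using ker_Delta_l_two(2)[OF G(2) k] unfolding G(3) G(1) by simp
  qed
  \<comment> \<open>With \<open>low\<close> this makes the set nonempty and bounded below, so that
    \<open>Inf\<close> is a genuine infimum.\<close>
  have mem: "calderon_norm l_infty l_one F \<in> ?N"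
    using F by blast
  have "Inf ?N \<le> calderon_norm l_infty l_one F"
    using mem low by (intro cInf_lower bdd_belowI[of _ "nrm l_two x / 1000"])
  then show "nrm X x \<le> 30 * nrm l_two x"
    using F(3) nX by linarith
  have "nrm l_two x / 1000 \<le> Inf ?N"
    using mem low by (intro cInf_greatest) auto
  then show "nrm l_two x \<le> 1000 * nrm X x"
    using nX by simp
qed

lemma same_spaceI:
  assumes "carr X = carr Y" "0 < c" "0 < C"
    and "\<And>x. x \<in> carr X \<Longrightarrow> c * nrm X x \<le> nrm Y x" "\<And>x. x \<in> carr X \<Longrightarrow> nrm Y x \<le> C * nrm X x"
  shows "same_space X Y"
  using assms unfolding same_space_def by blast

theorem proposition5p7:
  "same_space
     (image_space l_infty l_one (Delta l_infty l_one 1) (ker_Delta l_infty l_one 2))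
     (image_space l_infty l_one (Delta l_infty l_one 1) (ker_Delta l_infty l_one 0))
   \<and> same_space
     (image_space l_infty l_one (Delta l_infty l_one 1) (ker_Delta l_infty l_one 0))
     l_two"
proof -
  let ?X = "\<lambda>k. image_space l_infty l_one (Delta l_infty l_one 1) (ker_Delta l_infty l_one k)"
  note I0 = image_space_l_two[of 0, simplified] and I2 = image_space_l_two[of 2, simplified]
  have "same_space (?X 2) (?X 0)"
  \<comment> \<open>30000 = 30 * 1000, comparing the two quotient norms through
    \<open>l_two\<close>.\<close>
  proof (rule same_spaceI[where c = "1/30000" and C = 30000])
    fix x assume "x \<in> carr (?X 2)"
    then have x: "x \<in> carr l_two" by (simp add: I2)
    show "1/30000 * nrm (?X 2) x \<le> nrm (?X 0) x" "nrm (?X 0) x \<le> 30000 * nrm (?X 2) x"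
      using I0(2,3)[OF x] I2(2,3)[OF x] by simp_all
  qed (simp_all add: I0 I2)
  moreover have "same_space (?X 0) l_two"
  proof (rule same_spaceI[where c = "1/30" and C = 1000])
    fix x assume "x \<in> carr (?X 0)"
    then have x: "x \<in> carr l_two" by (simp add: I0)
    show "1/30 * nrm (?X 0) x \<le> nrm l_two x" "nrm l_two x \<le> 1000 * nrm (?X 0) x"
      using I0(2,3)[OF x] by simp_all
  qed (simp_all add: I0)
  ultimately show ?thesis ..
qed

end
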